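(* Let $(L,[-,-],\alpha,\beta)$ be an involutive BiHom-Lie algebra. If $r\in L\otimes L$ is a solution of the classical BiHom Yang-Baxter equation $\operatorname{CBHYB}(r)=0$ and satisfies $$r=-\tau(r),\qquad(\alpha\otimes\alpha)r=r,\qquad(\beta\otimes\beta)r=r,$$ then $(L,[-,-],\Delta_r,\alpha,\beta)$ is a BiHom-Lie bialgebra, where $\Delta_r:L\to L\otimes L$ is given by $\Delta_r(x)=(\mathrm{ad}_x\otimes\beta+\beta\otimes\mathrm{ad}_{\alpha^{-1}\beta(x)})r$.
   Context: All vector spaces are finite-dimensional over a field $\mathbf k$; $\tau(x\otimes y)=y\otimes x$; $\mathrm{ad}_x(y)=[x,y]$. **BiHom-Lie algebra** $(L,[-,-],\alpha,\beta)$: a vector space $L$, a bilinear map $[-,-]$ and two commuting linear maps $\alpha,\beta$ on $L$ with $\alpha([x,y])=[\alpha(x),\alpha(y)]$, $\beta([x,y])=[\beta(x),\beta(y)]$, $[\beta(x),\alpha(y)]=-[\beta(y),\alpha(x)]$ and $[\beta^2(x),[\beta(y),\alpha(z)]]+[\beta^2(y),[\beta(z),\alpha(x)]]+[\beta^2(z),[\beta(x),\alpha(y)]]=0$. It is **involutive** if $\alpha^2=\beta^2=\mathrm{id}_L$. **BiHom-Lie coalgebra** $(L,\Delta,\alpha,\beta)$: commuting linear maps $\alpha,\beta$ and a linear map $\Delta:L\to L\otimes L$ with $\Delta\alpha=(\alpha\otimes\alpha)\Delta$, $\Delta\beta=(\beta\otimes\beta)\Delta$, $(\beta\otimes\alpha)\Delta+\tau(\beta\otimes\alpha)\Delta=0$,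 and, with $J=(\mathrm{id}\otimes\beta\otimes\alpha)(\beta^2\otimes\Delta)\Delta$, $J+(\tau\otimes\mathrm{id})(\mathrm{id}\otimes\tau)J+(\mathrm{id}\otimes\tau)(\tau\otimes\mathrm{id})J=0$. **BiHom-Lie bialgebra** $(L,[-,-],\Delta,\alpha,\beta)$: $(L,[-,-],\alpha,\beta)$ is a BiHom-Lie algebra, $(L,\Delta,\alpha,\beta)$ is a BiHom-Lie coalgebra, $\alpha$ is invertible, and for all $x,y\in L$ $$\Delta([\alpha^{-1}\beta(x),y])=(\mathrm{ad}_{\beta(x)}\otimes\beta+\beta\otimes\mathrm{ad}_{\alpha^{-1}\beta^2(x)})\Delta(y)-(\mathrm{ad}_{\beta(y)}\otimes\beta+\beta\otimes\mathrm{ad}_{\alpha^{-1}\beta^2(y)})\Delta(x).$$ **CBHYBE.** Write $r=r_1\otimes r_2$ (summation suppressed) and let $\bar r_1\otimes\bar r_2$ be a second copy of $r$. Then $$\operatorname{CBHYB}(r)=[r_1,\alpha^{-1}\beta(\bar r_1)]\otimes\beta(r_2)\otimes\beta(\bar r_2)+\beta(r_1)\otimes[r_2,\alpha^{-1}\beta(\bar r_1)]\otimes\beta(\bar r_2)+\beta(r_1)\otimes\beta(\bar r_1)\otimes[r_2,\alpha^{-1}\beta(\bar r_2)].$$ *)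

theory Defs
  imports Complex_Main "HOL-Library.Poly_Mapping"
begin

section \<open>Tensor powers of a vector space\<close>

text \<open>
  A vector space is given by a scalar multiplication
  \<open>scale :: 'k::field \<Rightarrow> 'a::ab_group_add \<Rightarrow> 'a\<close> satisfying \<^locale>\<open>vector_space\<close>.
  The tensor powers \<open>L \<otimes> L\<close> and \<open>L \<otimes> L \<otimes> L\<close> are constructed as usual: the free vector space
  on \<open>L \<times> L\<close> (on \<open>L \<times> L \<times> L\<close>) modulo the span of the multilinearity relations. Since the relations
  depend on \<open>scale\<close>, the quotient cannot be a type; a tensor is an equivalence class, that is
  a set of formal linear combinations.
\<close>

subsection \<open>Free vector spaces\<close>

definition fscale :: "'k::field \<Rightarrow> ('b \<Rightarrow>\<^sub>0 'k) \<Rightarrow> ('b \<Rightarrow>\<^sub>0 'k)" where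
  "fscale c = Poly_Mapping.map ((*) c)"

definition gen :: "'b \<Rightarrow> ('b \<Rightarrow>\<^sub>0 'k::field)" where
  "gen p = Poly_Mapping.single p 1"

text \<open>The linear extension of a map defined on generators:\<close>

definition lin_ext :: "('b \<Rightarrow> ('c \<Rightarrow>\<^sub>0 'k::field)) \<Rightarrow> ('b \<Rightarrow>\<^sub>0 'k) \<Rightarrow> ('c \<Rightarrow>\<^sub>0 'k)" where
  "lin_ext g u = (\<Sum>p\<in>Poly_Mapping.keys u. fscale (Poly_Mapping.lookup u p) (g p))"

subsection \<open>Quotient by the multilinearity relations\<close>

text \<open>
  A slot inserts a vector at one position of a tuple whose other entries are fixed; a map on
  tuples is multilinear iff its composition with every slot is linear.
\<close>

definition slots2 :: "('a \<Rightarrow> 'a \<times> 'a) set" where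
  "slots2 = (\<Union>a. {\<lambda>x. (x, a), \<lambda>x. (a, x)})"

definition slots3 :: "('a \<Rightarrow> 'a \<times> 'a \<times> 'a) set" where
  "slots3 = (\<Union>a b. {\<lambda>x. (x, a, b), \<lambda>x. (a, x, b), \<lambda>x. (a, b, x)})"

definition tensor_rel ::
  "('k::field \<Rightarrow> 'a::ab_group_add \<Rightarrow> 'a) \<Rightarrow> ('a \<Rightarrow> 'b) set \<Rightarrow> ('b \<Rightarrow>\<^sub>0 'k) set" where
  "tensor_rel scale I =
     {gen (i (x + y)) - gen (i x) - gen (i y) | i x y. i \<in> I} \<union>
     {gen (i (scale c x)) - fscale c (gen (i x)) | i c x. i \<in> I}"

definition tensor_class ::
  "('k::field \<Rightarrow> 'a::ab_group_add \<Rightarrow> 'a) \<Rightarrow> ('a \<Rightarrow> 'b) set \<Rightarrow> ('b \<Rightarrow>\<^sub>0 'k) \<Rightarrow> ('b \<Rightarrow>\<^sub>0 'k) set" where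
  "tensor_class scale I u = {v. v - u \<in> module.span fscale (tensor_rel scale I)}"

definition tensor_space ::
  "('k::field \<Rightarrow> 'a::ab_group_add \<Rightarrow> 'a) \<Rightarrow> ('a \<Rightarrow> 'b) set \<Rightarrow> ('b \<Rightarrow>\<^sub>0 'k) set set" where
  "tensor_space scale I = tensor_class scale I ` UNIV"

definition rep :: "('b \<Rightarrow>\<^sub>0 'k::field) set \<Rightarrow> ('b \<Rightarrow>\<^sub>0 'k)" where
  "rep t = (SOME u. u \<in> t)"

definition tensor_zero where
  "tensor_zero scale I = tensor_class scale I 0"

definition tensor_add where
  "tensor_add scale I s t = tensor_class scale I (rep s + rep t)"

definition tensor_uminus where
  "tensor_uminus scale I t = tensor_class scale I (- rep t)"

definition tensor_scale where
  "tensor_scale scale I c t = tensor_class scale I (fscale c (rep t))"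

text \<open>
  The map into the tensor power with slots \<open>I\<close> induced by a map on generators. It does not depend
  on the representatives when \<open>g\<close> is multilinear modulo the relations, see
  \<open>induced_tensor_class\<close> below.
\<close>

definition induced where
  "induced scale I g t = tensor_class scale I (lin_ext g (rep t))"

subsection \<open>Maps between tensor powers\<close>

definition tensor_map2 where
  "tensor_map2 scale f g = induced scale slots2 (\<lambda>(x, y). gen (f x, g y))"

definition flip where
  "flip scale = induced scale slots2 (\<lambda>(x, y). gen (y, x))"

definition tensor_map3 where
  "tensor_map3 scale f g h = induced scale slots3 (\<lambda>(x, y, z). gen (f x, g y, h z))"

text \<open>\<open>\<tau> \<otimes> id\<close> and \<open>id \<otimes> \<tau>\<close>:\<close>

definition flip_id where
  "flip_id scale = induced scale slots3 (\<lambda>(x, y, z). gen (y, x, z))"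

definition id_flip where
  "id_flip scale = induced scale slots3 (\<lambda>(x, y, z). gen (x, z, y))"

text \<open>\<open>f \<otimes> \<Delta> : L \<otimes> L \<rightarrow> L \<otimes> L \<otimes> L\<close> for \<open>f : L \<rightarrow> L\<close> and \<open>\<Delta> : L \<rightarrow> L \<otimes> L\<close>:\<close>

definition tensor_map_comult where
  "tensor_map_comult scale f \<Delta> =
     induced scale slots3 (\<lambda>(x, y). lin_ext (\<lambda>(a, b). gen (f x, a, b)) (rep (\<Delta> y)))"

section \<open>BiHom-Lie structures\<close>

definition bihom_lie_algebra ::
  "('k::field \<Rightarrow> 'a::ab_group_add \<Rightarrow> 'a) \<Rightarrow> ('a \<Rightarrow> 'a \<Rightarrow> 'a) \<Rightarrow> ('a \<Rightarrow> 'a) \<Rightarrow> ('a \<Rightarrow> 'a) \<Rightarrow> bool" where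
  "bihom_lie_algebra scale br \<alpha> \<beta> \<longleftrightarrow>
     (\<forall>x. Vector_Spaces.linear scale scale (\<lambda>y. br x y)) \<and>
     (\<forall>y. Vector_Spaces.linear scale scale (\<lambda>x. br x y)) \<and>
     Vector_Spaces.linear scale scale \<alpha> \<and>
     Vector_Spaces.linear scale scale \<beta> \<and>
     \<alpha> \<circ> \<beta> = \<beta> \<circ> \<alpha> \<and>
     (\<forall>x y. \<alpha> (br x y) = br (\<alpha> x) (\<alpha> y)) \<and>
     (\<forall>x y. \<beta> (br x y) = br (\<beta> x) (\<beta> y)) \<and>
     (\<forall>x y. br (\<beta> x) (\<alpha> y) = - br (\<beta> y) (\<alpha> x)) \<and>
     (\<forall>x y z. br (\<beta> (\<beta> x)) (br (\<beta> y) (\<alpha> z)) + br (\<beta> (\<beta> y)) (br (\<beta> z) (\<alpha> x))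
              + br (\<beta> (\<beta> z)) (br (\<beta> x) (\<alpha> y)) = 0)"

definition involutive_bihom_lie_algebra ::
  "('k::field \<Rightarrow> 'a::ab_group_add \<Rightarrow> 'a) \<Rightarrow> ('a \<Rightarrow> 'a \<Rightarrow> 'a) \<Rightarrow> ('a \<Rightarrow> 'a) \<Rightarrow> ('a \<Rightarrow> 'a) \<Rightarrow> bool" where
  "involutive_bihom_lie_algebra scale br \<alpha> \<beta> \<longleftrightarrow>
     bihom_lie_algebra scale br \<alpha> \<beta> \<and> \<alpha> \<circ> \<alpha> = id \<and> \<beta> \<circ> \<beta> = id"

definition linear_comult ::
  "('k::field \<Rightarrow> 'a::ab_group_add \<Rightarrow> 'a) \<Rightarrow> ('a \<Rightarrow> ('a \<times> 'a \<Rightarrow>\<^sub>0 'k) set) \<Rightarrow> bool" where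
  "linear_comult scale \<Delta> \<longleftrightarrow>
     (\<forall>x. \<Delta> x \<in> tensor_space scale slots2) \<and>
     (\<forall>x y. \<Delta> (x + y) = tensor_add scale slots2 (\<Delta> x) (\<Delta> y)) \<and>
     (\<forall>c x. \<Delta> (scale c x) = tensor_scale scale slots2 c (\<Delta> x))"

definition bihom_lie_coalgebra ::
  "('k::field \<Rightarrow> 'a::ab_group_add \<Rightarrow> 'a) \<Rightarrow> ('a \<Rightarrow> ('a \<times> 'a \<Rightarrow>\<^sub>0 'k) set)
     \<Rightarrow> ('a \<Rightarrow> 'a) \<Rightarrow> ('a \<Rightarrow> 'a) \<Rightarrow> bool" where
  "bihom_lie_coalgebra scale \<Delta> \<alpha> \<beta> \<longleftrightarrow>
     Vector_Spaces.linear scale scale \<alpha> \<and>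
     Vector_Spaces.linear scale scale \<beta> \<and>
     \<alpha> \<circ> \<beta> = \<beta> \<circ> \<alpha> \<and>
     linear_comult scale \<Delta> \<and>
     (\<forall>x. \<Delta> (\<alpha> x) = tensor_map2 scale \<alpha> \<alpha> (\<Delta> x)) \<and>
     (\<forall>x. \<Delta> (\<beta> x) = tensor_map2 scale \<beta> \<beta> (\<Delta> x)) \<and>
     (\<forall>x. tensor_add scale slots2 (tensor_map2 scale \<beta> \<alpha> (\<Delta> x))
            (flip scale (tensor_map2 scale \<beta> \<alpha> (\<Delta> x))) = tensor_zero scale slots2) \<and>
     (\<forall>x. let J = tensor_map3 scale id \<beta> \<alpha> (tensor_map_comult scale (\<beta> \<circ> \<beta>) \<Delta> (\<Delta> x))
          in tensor_add scale slots3
               (tensor_add scale slots3 J (flip_id scale (id_flip scale J)))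
               (id_flip scale (flip_id scale J)) = tensor_zero scale slots3)"

text \<open>\<open>\<beta>\<^sup>2\<close> in \<open>\<alpha>\<^sup>-\<^sup>1\<beta>\<^sup>2\<close> is composition; \<open>ad\<^sub>x\<close> is the partial application \<open>br x\<close>.\<close>

definition bihom_lie_bialgebra ::
  "('k::field \<Rightarrow> 'a::ab_group_add \<Rightarrow> 'a) \<Rightarrow> ('a \<Rightarrow> 'a \<Rightarrow> 'a)
     \<Rightarrow> ('a \<Rightarrow> ('a \<times> 'a \<Rightarrow>\<^sub>0 'k) set) \<Rightarrow> ('a \<Rightarrow> 'a) \<Rightarrow> ('a \<Rightarrow> 'a) \<Rightarrow> bool" where
  "bihom_lie_bialgebra scale br \<Delta> \<alpha> \<beta> \<longleftrightarrow>
     bihom_lie_algebra scale br \<alpha> \<beta> \<and>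
     bihom_lie_coalgebra scale \<Delta> \<alpha> \<beta> \<and>
     bij \<alpha> \<and>
     (let D = (\<lambda>x t. tensor_add scale slots2
                 (tensor_map2 scale (br (\<beta> x)) \<beta> t)
                 (tensor_map2 scale \<beta> (br (inv \<alpha> (\<beta> (\<beta> x)))) t))
      in \<forall>x y. \<Delta> (br (inv \<alpha> (\<beta> x)) y) =
           tensor_add scale slots2 (D x (\<Delta> y)) (tensor_uminus scale slots2 (D y (\<Delta> x))))"

definition CBHYB ::
  "('k::field \<Rightarrow> 'a::ab_group_add \<Rightarrow> 'a) \<Rightarrow> ('a \<Rightarrow> 'a \<Rightarrow> 'a) \<Rightarrow> ('a \<Rightarrow> 'a) \<Rightarrow> ('a \<Rightarrow> 'a)
     \<Rightarrow> ('a \<times> 'a \<Rightarrow>\<^sub>0 'k) set \<Rightarrow> ('a \<times> 'a \<times> 'a \<Rightarrow>\<^sub>0 'k) set" where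
  "CBHYB scale br \<alpha> \<beta> r =
     induced scale slots3 (\<lambda>(r1, r2). lin_ext (\<lambda>(s1, s2).
         gen (br r1 (inv \<alpha> (\<beta> s1)), \<beta> r2, \<beta> s2)
       + gen (\<beta> r1, br r2 (inv \<alpha> (\<beta> s1)), \<beta> s2)
       + gen (\<beta> r1, \<beta> s1, br r2 (inv \<alpha> (\<beta> s2)))) (rep r)) r"

definition coboundary ::
  "('k::field \<Rightarrow> 'a::ab_group_add \<Rightarrow> 'a) \<Rightarrow> ('a \<Rightarrow> 'a \<Rightarrow> 'a) \<Rightarrow> ('a \<Rightarrow> 'a) \<Rightarrow> ('a \<Rightarrow> 'a)
     \<Rightarrow> ('a \<times> 'a \<Rightarrow>\<^sub>0 'k) set \<Rightarrow> 'a \<Rightarrow> ('a \<times> 'a \<Rightarrow>\<^sub>0 'k) set" where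
  "coboundary scale br \<alpha> \<beta> r x =
     tensor_add scale slots2
       (tensor_map2 scale (br x) \<beta> r)
       (tensor_map2 scale \<beta> (br (inv \<alpha> (\<beta> x))) r)"

section \<open>Independence of representatives\<close>

lemma lookup_fscale [simp]:
  "Poly_Mapping.lookup (fscale c u) p = c * Poly_Mapping.lookup u p"
  by (simp add: fscale_def Poly_Mapping.map.rep_eq when_def)

interpretation free: vector_space "fscale :: 'k::field \<Rightarrow> ('b \<Rightarrow>\<^sub>0 'k) \<Rightarrow> _"
  by unfold_locales (auto intro!: poly_mapping_eqI simp: lookup_add algebra_simps)

lemma tensor_class_eq_iff:
  "tensor_class scale I u = tensor_class scale I v \<longleftrightarrow> u - v \<in> free.span (tensor_rel scale I)"
proof
  assume "tensor_class scale I u = tensor_class scale I v"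
  moreover have "u \<in> tensor_class scale I u"
    by (simp add: tensor_class_def free.span_zero)
  ultimately show "u - v \<in> free.span (tensor_rel scale I)"
    by (simp add: tensor_class_def)
next
  assume h: "u - v \<in> free.span (tensor_rel scale I)"
  have "w - u \<in> free.span (tensor_rel scale I) \<longleftrightarrow> w - v \<in> free.span (tensor_rel scale I)" for w
    using free.span_add[OF _ h, of "w - u"] free.span_diff[OF _ h, of "w - v"] by auto
  then show "tensor_class scale I u = tensor_class scale I v"
    by (simp add: tensor_class_def)
qed

lemma rep_tensor_class:
  "tensor_class scale I (rep (tensor_class scale I u)) = tensor_class scale I u"
proof -
  have "u \<in> tensor_class scale I u"
    by (simp add: tensor_class_def free.span_zero)
  then have "rep (tensor_class scale I u) \<in> tensor_class scale I u"
    unfolding rep_def by (rule someI)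
  then show ?thesis
    by (subst tensor_class_eq_iff) (simp add: tensor_class_def)
qed

lemma rep_tensor_class_diff:
  "rep (tensor_class scale I u) - u \<in> free.span (tensor_rel scale I)"
  using rep_tensor_class by (simp add: tensor_class_eq_iff [symmetric])

lemma tensor_add_class:
  "tensor_add scale I (tensor_class scale I u) (tensor_class scale I v) = tensor_class scale I (u + v)"
  unfolding tensor_add_def tensor_class_eq_iff
  using free.span_add[OF rep_tensor_class_diff rep_tensor_class_diff]
  by (simp add: add_diff_add)

lemma tensor_uminus_class:
  "tensor_uminus scale I (tensor_class scale I u) = tensor_class scale I (- u)"
  unfolding tensor_uminus_def tensor_class_eq_iff
  using free.span_neg[OF rep_tensor_class_diff] by (metis minus_diff_minus)

lemma tensor_scale_class:
  "tensor_scale scale I c (tensor_class scale I u) = tensor_class scale I (fscale c u)"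
  unfolding tensor_scale_def tensor_class_eq_iff
  using free.span_scale[OF rep_tensor_class_diff, of c] by (metis free.scale_right_diff_distrib)

lemma lin_ext_superset:
  assumes "finite A" "Poly_Mapping.keys u \<subseteq> A"
  shows "lin_ext g u = (\<Sum>p\<in>A. fscale (Poly_Mapping.lookup u p) (g p))"
  unfolding lin_ext_def
  by (rule sum.mono_neutral_left) (use assms in \<open>auto simp: in_keys_iff\<close>)

lemma lin_ext_add: "lin_ext g (u + v) = lin_ext g u + lin_ext g v"
proof -
  let ?A = "Poly_Mapping.keys u \<union> Poly_Mapping.keys v"
  have "Poly_Mapping.keys (u + v) \<subseteq> ?A"
    by (rule Poly_Mapping.keys_add)
  then show ?thesis
    by (simp add: lin_ext_superset[where A = ?A] lookup_add free.scale_left_distrib sum.distrib)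
qed

lemma lin_ext_fscale: "lin_ext g (fscale c u) = fscale c (lin_ext g u)"
proof -
  have "Poly_Mapping.keys (fscale c u) \<subseteq> Poly_Mapping.keys u"
    by (auto simp: in_keys_iff)
  then show ?thesis
    by (simp add: lin_ext_superset[where A = "Poly_Mapping.keys u"] free.scale_sum_right)
qed

lemma lin_ext_linear: "Vector_Spaces.linear fscale fscale (lin_ext g)"
  by unfold_locales (simp_all add: lin_ext_add lin_ext_fscale)

lemma lin_ext_diff: "lin_ext g (u - v) = lin_ext g u - lin_ext g v"
  by (metis add_diff_cancel_right' diff_add_cancel lin_ext_add)

lemma lin_ext_gen [simp]: "lin_ext g (gen p) = g p"
  by (simp add: lin_ext_def gen_def)

lemma induced_tensor_class:
  assumes add: "\<And>i x y. i \<in> I \<Longrightarrow>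
      g (i (x + y)) - g (i x) - g (i y) \<in> free.span (tensor_rel scale J)"
    and scale: "\<And>i c x. i \<in> I \<Longrightarrow>
      g (i (scale c x)) - fscale c (g (i x)) \<in> free.span (tensor_rel scale J)"
  shows "induced scale J g (tensor_class scale I u) = tensor_class scale J (lin_ext g u)"
proof -
  have "lin_ext g w \<in> free.span (tensor_rel scale J)" if "w \<in> free.span (tensor_rel scale I)" for w
    using that
  proof (induction rule: free.span_induct_alt)
    case base
    show ?case by (simp add: lin_ext_def free.span_zero)
  next
    case (step c x y)
    have "lin_ext g x \<in> free.span (tensor_rel scale J)"
      using step.hyps(1) add scale unfolding tensor_rel_def[of scale I]
      by (auto simp: lin_ext_diff lin_ext_fscale)
    with step show ?case
      by (simp add: lin_ext_add lin_ext_fscale free.span_add free.span_scale)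
  qed
  from this[OF rep_tensor_class_diff] show ?thesis
    by (simp add: induced_def tensor_class_eq_iff lin_ext_diff)
qed

lemma span_tensor_rel_add:
  "i \<in> I \<Longrightarrow> gen (i (x + y)) - gen (i x) - gen (i y) \<in> free.span (tensor_rel scale I)"
  by (rule free.span_base) (unfold tensor_rel_def, blast)

lemma span_tensor_rel_scale:
  "i \<in> I \<Longrightarrow> gen (i (scale c x)) - fscale c (gen (i x)) \<in> free.span (tensor_rel scale I)"
  by (rule free.span_base) (unfold tensor_rel_def, blast)

lemma slots2_cases:
  assumes "i \<in> slots2"
  obtains a where "i = (\<lambda>x. (x, a))" | a where "i = (\<lambda>x. (a, x))"
  using assms by (auto simp: slots2_def)

lemma slots3_cases:
  assumes "i \<in> slots3"
  obtains a b where "i = (\<lambda>x. (x, a, b))" | a b where "i = (\<lambda>x. (a, x, b))"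
    | a b where "i = (\<lambda>x. (a, b, x))"
  using assms by (auto simp: slots3_def)

lemma slots2_rel:
  "gen (x + y, a) - gen (x, a) - gen (y, a) \<in> free.span (tensor_rel scale slots2)"
  "gen (a, x + y) - gen (a, x) - gen (a, y) \<in> free.span (tensor_rel scale slots2)"
  "gen (scale c x, a) - fscale c (gen (x, a)) \<in> free.span (tensor_rel scale slots2)"
  "gen (a, scale c x) - fscale c (gen (a, x)) \<in> free.span (tensor_rel scale slots2)"
  by (rule span_tensor_rel_add[where i = "\<lambda>x. (x, a)"]
        span_tensor_rel_add[where i = "\<lambda>x. (a, x)"]
        span_tensor_rel_scale[where i = "\<lambda>x. (x, a)"]
        span_tensor_rel_scale[where i = "\<lambda>x. (a, x)"]; auto simp: slots2_def)+

lemma slots3_rel: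
  "gen (x + y, a, b) - gen (x, a, b) - gen (y, a, b) \<in> free.span (tensor_rel scale slots3)"
  "gen (a, x + y, b) - gen (a, x, b) - gen (a, y, b) \<in> free.span (tensor_rel scale slots3)"
  "gen (a, b, x + y) - gen (a, b, x) - gen (a, b, y) \<in> free.span (tensor_rel scale slots3)"
  "gen (scale c x, a, b) - fscale c (gen (x, a, b)) \<in> free.span (tensor_rel scale slots3)"
  "gen (a, scale c x, b) - fscale c (gen (a, x, b)) \<in> free.span (tensor_rel scale slots3)"
  "gen (a, b, scale c x) - fscale c (gen (a, b, x)) \<in> free.span (tensor_rel scale slots3)"
  by (rule span_tensor_rel_add[where i = "\<lambda>x. (x, a, b)"]
        span_tensor_rel_add[where i = "\<lambda>x. (a, x, b)"]
        span_tensor_rel_add[where i = "\<lambda>x. (a, b, x)"]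
        span_tensor_rel_scale[where i = "\<lambda>x. (x, a, b)"]
        span_tensor_rel_scale[where i = "\<lambda>x. (a, x, b)"]
        span_tensor_rel_scale[where i = "\<lambda>x. (a, b, x)"]; auto simp: slots3_def)+

lemma linear_add_scale:
  assumes "Vector_Spaces.linear s s f"
  shows "f (x + y) = f x + f y" "f (s c x) = s c (f x)"
  using assms by (auto simp: Vector_Spaces.linear.axioms module_hom.add module_hom.scale
      dest!: Vector_Spaces.linear.axioms(3))

lemma tensor_map2_class:
  assumes "Vector_Spaces.linear scale scale f" "Vector_Spaces.linear scale scale g"
  shows "tensor_map2 scale f g (tensor_class scale slots2 u) =
    tensor_class scale slots2 (lin_ext (\<lambda>(x, y). gen (f x, g y)) u)"
  unfolding tensor_map2_def
  by (rule induced_tensor_class; erule slots2_cases;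
      simp add: slots2_rel linear_add_scale[OF assms(1)] linear_add_scale[OF assms(2)])

lemma flip_class:
  "flip scale (tensor_class scale slots2 u) =
    tensor_class scale slots2 (lin_ext (\<lambda>(x, y). gen (y, x)) u)"
  unfolding flip_def
  by (rule induced_tensor_class; erule slots2_cases; simp add: slots2_rel)

lemma tensor_map3_class:
  assumes "Vector_Spaces.linear scale scale f" "Vector_Spaces.linear scale scale g"
    "Vector_Spaces.linear scale scale h"
  shows "tensor_map3 scale f g h (tensor_class scale slots3 u) =
    tensor_class scale slots3 (lin_ext (\<lambda>(x, y, z). gen (f x, g y, h z)) u)"
  unfolding tensor_map3_def
  by (rule induced_tensor_class; erule slots3_cases;
      simp add: slots3_rel linear_add_scale[OF assms(1)] linear_add_scale[OF assms(2)]
        linear_add_scale[OF assms(3)])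

lemma flip_id_class:
  "flip_id scale (tensor_class scale slots3 u) =
    tensor_class scale slots3 (lin_ext (\<lambda>(x, y, z). gen (y, x, z)) u)"
  unfolding flip_id_def
  by (rule induced_tensor_class; erule slots3_cases; simp add: slots3_rel)

lemma id_flip_class:
  "id_flip scale (tensor_class scale slots3 u) =
    tensor_class scale slots3 (lin_ext (\<lambda>(x, y, z). gen (x, z, y)) u)"
  unfolding id_flip_def
  by (rule induced_tensor_class; erule slots3_cases; simp add: slots3_rel)

lemma lin_ext_span:
  assumes "\<And>p. g p \<in> free.span R"
  shows "lin_ext g u \<in> free.span R"
  unfolding lin_ext_def by (intro free.span_sum free.span_scale assms)

lemma lin_ext_fun_diff: "lin_ext g u - lin_ext h u = lin_ext (\<lambda>p. g p - h p) u"
  by (simp add: lin_ext_def free.scale_right_diff_distrib sum_subtractf)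

lemma lin_ext_fun_fscale: "fscale c (lin_ext g u) = lin_ext (\<lambda>p. fscale c (g p)) u"
  by (simp add: lin_ext_def free.scale_sum_right mult.commute)

lemma lin_ext_rep_class:
  assumes "\<And>i x y. i \<in> I \<Longrightarrow>
      g (i (x + y)) - g (i x) - g (i y) \<in> free.span (tensor_rel scale J)"
    and "\<And>i c x. i \<in> I \<Longrightarrow>
      g (i (scale c x)) - fscale c (g (i x)) \<in> free.span (tensor_rel scale J)"
    and "tensor_class scale I u = tensor_class scale I v"
  shows "lin_ext g u - lin_ext g v \<in> free.span (tensor_rel scale J)"
  using induced_tensor_class[of I g scale J u] induced_tensor_class[of I g scale J v] assms
  by (simp add: tensor_class_eq_iff [symmetric])

lemma tensor_space_rep: "t \<in> tensor_space scale I \<Longrightarrow> tensor_class scale I (rep t) = t"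
  by (auto simp: tensor_space_def rep_tensor_class)

lemma tensor_map_comult_class:
  assumes f: "Vector_Spaces.linear scale scale f" and D: "linear_comult scale \<Delta>"
  shows "tensor_map_comult scale f \<Delta> (tensor_class scale slots2 u) =
    tensor_class scale slots3
      (lin_ext (\<lambda>(x, y). lin_ext (\<lambda>(a, b). gen (f x, a, b)) (rep (\<Delta> y))) u)"
proof -
  let ?S = "free.span (tensor_rel scale slots3)"
  let ?h = "\<lambda>x (a, b). gen (f x, a, b)"
  have resp: "lin_ext (?h x) v - lin_ext (?h x) w \<in> ?S"
    if "tensor_class scale slots2 v = tensor_class scale slots2 w" for x v w
    by (rule lin_ext_rep_class[OF _ _ that]; erule slots2_cases; simp add: slots3_rel)
  have cl: "tensor_class scale slots2 (rep (\<Delta> y)) = \<Delta> y" for y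
    using D by (simp add: linear_comult_def tensor_space_rep)
  have add2: "lin_ext (?h x) (rep (\<Delta> (y + z))) - lin_ext (?h x) (rep (\<Delta> y))
      - lin_ext (?h x) (rep (\<Delta> z)) \<in> ?S" for x y z
  proof -
    have "tensor_class scale slots2 (rep (\<Delta> (y + z)))
        = tensor_class scale slots2 (rep (\<Delta> y) + rep (\<Delta> z))"
      using D cl by (simp add: linear_comult_def tensor_add_def rep_tensor_class)
    from resp[OF this] show ?thesis
      by (simp add: lin_ext_add diff_diff_eq)
  qed
  have scale2: "lin_ext (?h x) (rep (\<Delta> (scale c y))) - fscale c (lin_ext (?h x) (rep (\<Delta> y))) \<in> ?S"
    for x y c
  proof -
    have "tensor_class scale slots2 (rep (\<Delta> (scale c y)))
        = tensor_class scale slots2 (fscale c (rep (\<Delta> y)))"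
      using D cl by (simp add: linear_comult_def tensor_scale_def rep_tensor_class)
    from resp[OF this] show ?thesis
      by (simp add: lin_ext_fscale)
  qed
  have 1: "lin_ext (?h (x + y)) v - lin_ext (?h x) v - lin_ext (?h y) v \<in> ?S" for x y v
    unfolding lin_ext_fun_diff
    by (rule lin_ext_span) (auto simp: slots3_rel linear_add_scale[OF f])
  have 2: "lin_ext (?h (scale c x)) v - fscale c (lin_ext (?h x) v) \<in> ?S" for x c v
    unfolding lin_ext_fun_fscale lin_ext_fun_diff
    by (rule lin_ext_span) (auto simp: slots3_rel linear_add_scale[OF f])
  show ?thesis
    unfolding tensor_map_comult_def
    by (rule induced_tensor_class; erule slots2_cases; simp add: 1 2 add2 scale2)
qed

lemma CBHYB_class:
  fixes scale :: "'k::field \<Rightarrow> 'a::ab_group_add \<Rightarrow> 'a"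
  assumes "bihom_lie_algebra scale br \<alpha> \<beta>" "bij \<alpha>"
  shows "CBHYB scale br \<alpha> \<beta> (tensor_class scale slots2 u) =
    tensor_class scale slots3 (lin_ext (\<lambda>(r1, r2). lin_ext (\<lambda>(s1, s2).
         gen (br r1 (inv \<alpha> (\<beta> s1)), \<beta> r2, \<beta> s2)
       + gen (\<beta> r1, br r2 (inv \<alpha> (\<beta> s1)), \<beta> s2)
       + gen (\<beta> r1, \<beta> s1, br r2 (inv \<alpha> (\<beta> s2)))) u) u)"
proof -
  let ?S = "free.span (tensor_rel scale slots3)"
  define h where "h = (\<lambda>(r1, r2) (s1, s2).
         gen (br r1 (inv \<alpha> (\<beta> s1)), \<beta> r2, \<beta> s2)
       + gen (\<beta> r1, br r2 (inv \<alpha> (\<beta> s1)), \<beta> s2)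
       + gen (\<beta> r1, \<beta> s1, br r2 (inv \<alpha> (\<beta> s2))) :: _ \<Rightarrow>\<^sub>0 'k)"
  have lin: "Vector_Spaces.linear scale scale (br x)" "Vector_Spaces.linear scale scale (\<lambda>y. br y x)"
    "Vector_Spaces.linear scale scale \<alpha>" "Vector_Spaces.linear scale scale \<beta>" for x
    using assms(1) by (auto simp: bihom_lie_algebra_def)
  have inv: "inv \<alpha> (x + y) = inv \<alpha> x + inv \<alpha> y" "inv \<alpha> (scale c x) = scale c (inv \<alpha> x)" for c x y
    using assms(2) linear_add_scale[OF lin(3)]
    by (metis bij_inv_eq_iff)+
  note ls = linear_add_scale[OF lin(1)] linear_add_scale[OF lin(2)] linear_add_scale[OF lin(4)] inv
  have sum3: "(a1 + a2 + a3) - (b1 + b2 + b3) - (c1 + c2 + c3) \<in> ?S"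
    if "a1 - b1 - c1 \<in> ?S" "a2 - b2 - c2 \<in> ?S" "a3 - b3 - c3 \<in> ?S"
    for a1 a2 a3 b1 b2 b3 c1 c2 c3
    using free.span_add[OF free.span_add[OF that(1,2)] that(3)] by (simp add: algebra_simps)
  have scl3: "(a1 + a2 + a3) - fscale c (b1 + b2 + b3) \<in> ?S"
    if "a1 - fscale c b1 \<in> ?S" "a2 - fscale c b2 \<in> ?S" "a3 - fscale c b3 \<in> ?S"
    for a1 a2 a3 b1 b2 b3 c
    using free.span_add[OF free.span_add[OF that(1,2)] that(3)]
    by (simp add: algebra_simps free.scale_right_distrib)
  have R: "h (i (x + y)) p - h (i x) p - h (i y) p \<in> ?S"
    "h (i (scale c x)) p - fscale c (h (i x) p) \<in> ?S"
    "h p (i (x + y)) - h p (i x) - h p (i y) \<in> ?S"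
    "h p (i (scale c x)) - fscale c (h p (i x)) \<in> ?S"
    if "i \<in> slots2" for i x y c p
    by (insert that, (cases p; erule slots2_cases;
        simp add: h_def ls; intro sum3 scl3; simp add: slots3_rel)+)
  have A: "lin_ext (\<lambda>p. lin_ext (h p) v) (rep (tensor_class scale slots2 u))
      - lin_ext (\<lambda>p. lin_ext (h p) v) u \<in> ?S" for v
    by (rule lin_ext_rep_class[OF _ _ rep_tensor_class];
        unfold lin_ext_fun_fscale lin_ext_fun_diff; rule lin_ext_span; simp add: R)
  have B: "lin_ext (\<lambda>p. lin_ext (h p) (rep (tensor_class scale slots2 u))) u
      - lin_ext (\<lambda>p. lin_ext (h p) u) u \<in> ?S"
    unfolding lin_ext_fun_diff[of "\<lambda>p. lin_ext (h p) _"]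
    by (rule lin_ext_span, rule lin_ext_rep_class[OF _ _ rep_tensor_class]; simp add: R)
  have "lin_ext (\<lambda>p. lin_ext (h p) (rep (tensor_class scale slots2 u)))
        (rep (tensor_class scale slots2 u)) - lin_ext (\<lambda>p. lin_ext (h p) u) u \<in> ?S"
    using free.span_add[OF A[of "rep (tensor_class scale slots2 u)"] B] by simp
  then show ?thesis
    by (simp add: CBHYB_def induced_def tensor_class_eq_iff h_def case_prod_unfold)
qed

end

theory Submission
  imports Defs
begin

text \<open>
  The twist can be undone. Since \<open>\<alpha>\<close> and \<open>\<beta>\<close> are commuting involutions,
  \<open>{x, y} = [\<alpha> x, \<beta> y]\<close> is an ordinary Lie bracket (bilinear, antisymmetric, satisfying the
  Jacobi identity) with automorphisms \<open>\<alpha>\<close> and \<open>\<beta>\<close>. Twist \<open>r\<close> as well and put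
  \<open>r' = (\<beta>\<alpha> \<otimes> id) r\<close>. The invariance and skewness of \<open>r\<close> make \<open>r'\<close> skew and invariant, and
  turn \<open>CBHYB(r) = 0\<close> into the classical Yang-Baxter equation
  \<open>[r'\<^sub>1\<^sub>2, r'\<^sub>1\<^sub>3] + [r'\<^sub>1\<^sub>2, r'\<^sub>2\<^sub>3] + [r'\<^sub>1\<^sub>3, r'\<^sub>2\<^sub>3] = 0\<close> for \<open>{-, -}\<close>. So \<open>r'\<close> is
  a triangular r-matrix, and its cobracket \<open>\<delta>(x) = x \<cdot> r'\<close> is skew and a 1-cocycle for formal
  reasons, while the cyclic sum of \<open>(id \<otimes> \<delta>) \<delta>(x)\<close> is \<open>x\<close> applied to the left-hand side of the
  Yang-Baxter equation, hence \<open>0\<close> (\<open>cobracket_cojacobi\<close>).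

  The BiHom structure is recovered by \<open>\<Delta>\<^sub>r = (\<alpha> \<otimes> \<beta>) \<delta>\<close> (\<open>coboundary_twisted\<close>), and \<open>\<delta>\<close>
  commutes with \<open>\<alpha>\<close> and \<open>\<beta>\<close>. Each axiom for \<open>\<Delta>\<^sub>r\<close> thereby becomes the
  corresponding axiom for \<open>\<delta>\<close>, twisted: for instance \<open>(\<beta> \<otimes> \<alpha>) \<Delta>\<^sub>r = (\<beta>\<alpha> \<otimes> \<beta>\<alpha>) \<delta>\<close>, and
  \<open>J = (\<alpha> \<otimes> \<alpha> \<otimes> \<alpha>)(id \<otimes> \<delta>) \<delta>\<close>.

  Equations between tensors are checked by evaluating multilinear forms with values in the field:
  these separate the points of a tensor power (\<open>tensor_class_eq_iff_forms\<close>). Every tensor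
  identity becomes an identity between finite sums of scalars, in which quotients and
  representatives no longer occur.
\<close>

section \<open>Multilinear forms on formal tensors\<close>

definition pairing :: "('b \<Rightarrow> 'k::field) \<Rightarrow> ('b \<Rightarrow>\<^sub>0 'k) \<Rightarrow> 'k" where
  "pairing \<phi> u = (\<Sum>p\<in>Poly_Mapping.keys u. Poly_Mapping.lookup u p * \<phi> p)"

definition multilinear_form ::
  "('k::field \<Rightarrow> 'a::ab_group_add \<Rightarrow> 'a) \<Rightarrow> ('a \<Rightarrow> 'b) set \<Rightarrow> ('b \<Rightarrow> 'k) \<Rightarrow> bool" where
  "multilinear_form scale I \<phi> \<longleftrightarrow>
     (\<forall>i\<in>I. (\<forall>x y. \<phi> (i (x + y)) = \<phi> (i x) + \<phi> (i y)) \<and>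
             (\<forall>c x. \<phi> (i (scale c x)) = c * \<phi> (i x)))"

lemma pairing_superset:
  assumes "finite A" "Poly_Mapping.keys u \<subseteq> A"
  shows "pairing \<phi> u = (\<Sum>p\<in>A. Poly_Mapping.lookup u p * \<phi> p)"
  unfolding pairing_def
  by (rule sum.mono_neutral_left) (use assms in \<open>auto simp: in_keys_iff\<close>)

lemma pairing_add [simp]: "pairing \<phi> (u + v) = pairing \<phi> u + pairing \<phi> v"
proof -
  let ?A = "Poly_Mapping.keys u \<union> Poly_Mapping.keys v"
  have "Poly_Mapping.keys (u + v) \<subseteq> ?A"
    by (rule Poly_Mapping.keys_add)
  then show ?thesis
    by (simp add: pairing_superset[where A = ?A] lookup_add distrib_right sum.distrib)
qed

lemma pairing_fscale [simp]: "pairing \<phi> (fscale c u) = c * pairing \<phi> u"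
proof -
  have "Poly_Mapping.keys (fscale c u) \<subseteq> Poly_Mapping.keys u"
    by (auto simp: in_keys_iff)
  then show ?thesis
    by (simp add: pairing_superset[where A = "Poly_Mapping.keys u"] sum_distrib_left mult.assoc)
qed

lemma pairing_zero [simp]: "pairing \<phi> 0 = 0"
  by (simp add: pairing_def)

lemma pairing_uminus [simp]: "pairing \<phi> (- u) = - pairing \<phi> u"
  using pairing_add[of \<phi> u "- u"] by (simp add: eq_neg_iff_add_eq_0 add.commute)

lemma pairing_diff [simp]: "pairing \<phi> (u - v) = pairing \<phi> u - pairing \<phi> v"
  using pairing_add[of \<phi> u "- v"] by simp

lemma pairing_gen [simp]: "pairing \<phi> (gen p) = \<phi> p"
  by (simp add: pairing_def gen_def)

lemma pairing_sum: "pairing \<phi> (\<Sum>p\<in>A. f p) = (\<Sum>p\<in>A. pairing \<phi> (f p))"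
  by (induction A rule: infinite_finite_induct) auto

lemma pairing_lin_ext [simp]: "pairing \<phi> (lin_ext g u) = pairing (\<lambda>p. pairing \<phi> (g p)) u"
  by (simp add: lin_ext_def pairing_sum) (simp add: pairing_def)

lemma pairing_fun_add: "pairing (\<lambda>p. f p + g p) u = pairing f u + pairing g u"
  by (simp add: pairing_def distrib_left sum.distrib)

lemma pairing_fun_diff: "pairing (\<lambda>p. f p - g p) u = pairing f u - pairing g u"
  by (simp add: pairing_def right_diff_distrib sum_subtractf)

lemma pairing_fun_uminus: "pairing (\<lambda>p. - f p) u = - pairing f u"
  by (simp add: pairing_def sum_negf)

lemma pairing_fun_mult: "pairing (\<lambda>p. c * f p) u = c * pairing f u"
  by (simp add: pairing_def sum_distrib_left mult.left_commute)

text \<open>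
  Fubini for finite sums. It is what allows two copies of an r-matrix to be interchanged.
\<close>

lemma pairing_swap:
  "pairing (\<lambda>p. pairing (\<lambda>q. f p q) v) u = pairing (\<lambda>q. pairing (\<lambda>p. f p q) u) v"
  unfolding pairing_def sum_distrib_left
  by (subst sum.swap) (simp add: mult.left_commute)

lemmas pairing_fun = pairing_fun_add pairing_fun_diff pairing_fun_uminus pairing_fun_mult

lemma functional_eq_pairing:
  fixes \<phi> :: "('b \<Rightarrow>\<^sub>0 'k::field) \<Rightarrow> 'k"
  assumes "Vector_Spaces.linear fscale (*) \<phi>"
  shows "\<phi> u = pairing (\<phi> \<circ> gen) u"
proof -
  interpret \<phi>: Vector_Spaces.linear fscale "(*)" \<phi> by fact
  have "lin_ext gen u = u"
  proof (rule poly_mapping_eqI)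
    fix p
    have "Poly_Mapping.lookup (lin_ext gen u) p
        = (\<Sum>q\<in>Poly_Mapping.keys u. if q = p then Poly_Mapping.lookup u q else 0)"
      unfolding lin_ext_def lookup_sum
      by (rule sum.cong) (auto simp: gen_def lookup_single when_def)
    also have "\<dots> = Poly_Mapping.lookup u p"
      by (simp add: in_keys_iff)
    finally show "Poly_Mapping.lookup (lin_ext gen u) p = Poly_Mapping.lookup u p" .
  qed
  then have "\<phi> u = \<phi> (lin_ext gen u)" by simp
  also have "\<dots> = pairing (\<phi> \<circ> gen) u"
    by (simp add: lin_ext_def pairing_def \<phi>.sum \<phi>.scale)
  finally show ?thesis .
qed

text \<open>
  A basis of the span of \<open>R\<close> together with \<open>w\<close> is independent, so a functional can be prescribed
  on it.
\<close>

lemma exists_separating_functional: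
  fixes w :: "'b \<Rightarrow>\<^sub>0 'k::field"
  assumes "w \<notin> free.span R"
  obtains \<phi> :: "('b \<Rightarrow>\<^sub>0 'k) \<Rightarrow> 'k" where "Vector_Spaces.linear fscale (*) \<phi>"
    "\<And>v. v \<in> R \<Longrightarrow> \<phi> v = 0" "\<phi> w = 1"
proof -
  interpret k: vector_space "(*) :: 'k \<Rightarrow> 'k \<Rightarrow> 'k"
    by unfold_locales (auto simp: algebra_simps)
  interpret P: vector_space_pair "fscale :: 'k \<Rightarrow> ('b \<Rightarrow>\<^sub>0 'k) \<Rightarrow> _" "(*) :: 'k \<Rightarrow> 'k \<Rightarrow> 'k" ..
  obtain B where B: "B \<subseteq> R" "free.independent B" "R \<subseteq> free.span B"
    using free.maximal_independent_subset[of R] by blast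
  have w: "w \<notin> free.span B"
    using assms free.span_mono[OF B(1)] by blast
  then have "free.independent (insert w B)"
    using B(2) by (rule free.independent_insertI)
  then obtain \<phi> where \<phi>: "Vector_Spaces.linear fscale (*) \<phi>"
    "\<forall>v\<in>insert w B. \<phi> v = (if v = w then 1 else 0)"
    using P.linear_independent_extend[of "insert w B" "\<lambda>v. if v = w then 1 else 0"] by blast
  interpret \<phi>: Vector_Spaces.linear fscale "(*)" \<phi> by fact
  have "w \<notin> B" using w free.span_base by blast
  then have "\<phi> v = 0" if "v \<in> B" for v using that \<phi>(2) by auto
  then have "\<phi> v = 0" if "v \<in> R" for v
    using that B(3) P.linear_eq_0_on_span[OF \<phi>(1), of B v] by blast
  then show ?thesis using that \<phi> by auto
qed

text \<open>
  The universal property of the tensor power, for maps into the field: multilinear forms are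
  exactly the functionals on formal combinations that kill the relations. They suffice to detect
  equality because a vector outside the span of the relations is separated from it by a functional.
\<close>

lemma tensor_class_eq_iff_forms:
  "tensor_class scale I u = tensor_class scale I v \<longleftrightarrow>
     (\<forall>\<phi>. multilinear_form scale I \<phi> \<longrightarrow> pairing \<phi> u = pairing \<phi> v)"
proof
  assume "tensor_class scale I u = tensor_class scale I v"
  then have *: "u - v \<in> free.span (tensor_rel scale I)"
    by (simp add: tensor_class_eq_iff)
  show "\<forall>\<phi>. multilinear_form scale I \<phi> \<longrightarrow> pairing \<phi> u = pairing \<phi> v"
  proof (intro allI impI)
    fix \<phi> assume \<phi>: "multilinear_form scale I \<phi>"
    have "pairing \<phi> (u - v) = 0"
      using *
    proof (induction rule: free.span_induct_alt)
      case (step c x y)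
      then have "pairing \<phi> x = 0"
        using \<phi> by (auto simp: tensor_rel_def multilinear_form_def)
      with step show ?case by simp
    qed simp
    then show "pairing \<phi> u = pairing \<phi> v" by simp
  qed
next
  assume forms: "\<forall>\<phi>. multilinear_form scale I \<phi> \<longrightarrow> pairing \<phi> u = pairing \<phi> v"
  have "u - v \<in> free.span (tensor_rel scale I)"
  proof (rule ccontr)
    assume "u - v \<notin> free.span (tensor_rel scale I)"
    then obtain \<phi> where \<phi>: "Vector_Spaces.linear fscale (*) \<phi>"
      "\<And>w. w \<in> tensor_rel scale I \<Longrightarrow> \<phi> w = 0" "\<phi> (u - v) = 1"
      using exists_separating_functional[of "u - v" "tensor_rel scale I"] by blast
    interpret \<phi>: Vector_Spaces.linear fscale "(*)" \<phi> by fact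
    have "multilinear_form scale I (\<phi> \<circ> gen)"
      unfolding multilinear_form_def
    proof (intro ballI conjI allI)
      fix i x y assume "i \<in> I"
      then have "\<phi> (gen (i (x + y)) - gen (i x) - gen (i y)) = 0"
        by (intro \<phi>(2)) (unfold tensor_rel_def, blast)
      then show "(\<phi> \<circ> gen) (i (x + y)) = (\<phi> \<circ> gen) (i x) + (\<phi> \<circ> gen) (i y)"
        by (simp add: \<phi>.diff \<phi>.add algebra_simps)
    next
      fix i c x assume "i \<in> I"
      then have "\<phi> (gen (i (scale c x)) - fscale c (gen (i x))) = 0"
        by (intro \<phi>(2)) (unfold tensor_rel_def, blast)
      then show "(\<phi> \<circ> gen) (i (scale c x)) = c * (\<phi> \<circ> gen) (i x)"
        by (simp add: \<phi>.diff \<phi>.scale)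
    qed
    with forms have "\<phi> u = \<phi> v"
      by (simp add: functional_eq_pairing[OF \<phi>(1)])
    with \<phi>(3) show False by (simp add: \<phi>.diff)
  qed
  then show "tensor_class scale I u = tensor_class scale I v"
    by (simp add: tensor_class_eq_iff)
qed

lemma pairing_rep_class:
  "multilinear_form scale I \<phi> \<Longrightarrow> pairing \<phi> (rep (tensor_class scale I u)) = pairing \<phi> u"
  using rep_tensor_class tensor_class_eq_iff_forms by blast

lemma multilinear_form_slots2:
  "multilinear_form scale slots2 f \<longleftrightarrow>
     (\<forall>x y a. f (x + y, a) = f (x, a) + f (y, a)) \<and> (\<forall>x y a. f (a, x + y) = f (a, x) + f (a, y)) \<and>
     (\<forall>c x a. f (scale c x, a) = c * f (x, a)) \<and> (\<forall>c x a. f (a, scale c x) = c * f (a, x))"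
  by (auto simp: multilinear_form_def slots2_def)

lemma multilinear_form_slots3:
  "multilinear_form scale slots3 f \<longleftrightarrow>
     (\<forall>x y a b. f (x + y, a, b) = f (x, a, b) + f (y, a, b)) \<and>
     (\<forall>x y a b. f (a, x + y, b) = f (a, x, b) + f (a, y, b)) \<and>
     (\<forall>x y a b. f (a, b, x + y) = f (a, b, x) + f (a, b, y)) \<and>
     (\<forall>c x a b. f (scale c x, a, b) = c * f (x, a, b)) \<and>
     (\<forall>c x a b. f (a, scale c x, b) = c * f (a, x, b)) \<and>
     (\<forall>c x a b. f (a, b, scale c x) = c * f (a, b, x))"
  by (auto simp: multilinear_form_def slots3_def)

section \<open>The coboundary of a triangular r-matrix\<close>

text \<open>
  This is \<open>x \<cdot> u\<close> for the adjoint action of \<open>x\<close> on \<open>L \<otimes> L\<close>; as a function of \<open>x\<close> it is the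
  coboundary of \<open>u\<close>.
\<close>

definition cobracket ::
  "('a \<Rightarrow> 'a \<Rightarrow> 'a) \<Rightarrow> ('a \<times> 'a \<Rightarrow>\<^sub>0 'k::field) \<Rightarrow> 'a \<Rightarrow> ('a \<times> 'a \<Rightarrow>\<^sub>0 'k)" where
  "cobracket br u x = lin_ext (\<lambda>(a, b). gen (br x a, b) + gen (a, br x b)) u"

lemma pairing_cobracket:
  "pairing f (cobracket br u x) = pairing (\<lambda>(a, b). f (br x a, b) + f (a, br x b)) u"
  by (simp add: cobracket_def case_prod_unfold)

text \<open>
  Antisymmetry is weaker than \<open>br x x = 0\<close> in characteristic 2. The Jacobi identity is
  written as the statement that \<open>br\<close> turns brackets into commutators, the form in which it acts
  on tensors.
\<close>

locale lie_bracket =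
  fixes scale :: "'k::field \<Rightarrow> 'a::ab_group_add \<Rightarrow> 'a"
    and br :: "'a \<Rightarrow> 'a \<Rightarrow> 'a"
  assumes add_left: "br (x + y) z = br x z + br y z"
    and add_right: "br x (y + z) = br x y + br x z"
    and scale_left: "br (scale c x) y = scale c (br x y)"
    and scale_right: "br x (scale c y) = scale c (br x y)"
    and anticommute: "br x y = - br y x"
    and jacobi: "br (br x y) z = br x (br y z) - br y (br x z)"
begin

lemmas bilinear = add_left add_right scale_left scale_right

text \<open>
  \<open>{x, y} \<cdot> u = x \<cdot> (y \<cdot> u) - y \<cdot> (x \<cdot> u)\<close>: the Jacobi identity in either factor, while the sum of
  the mixed terms \<open>{x, a} \<otimes> {y, b}\<close> and \<open>{y, a} \<otimes> {x, b}\<close> is symmetric in \<open>x\<close> and \<open>y\<close> and cancels.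
\<close>

lemma cobracket_cocycle:
  assumes "multilinear_form scale slots2 f"
  shows "pairing f (cobracket br u (br x y)) =
    pairing (\<lambda>(a, b). f (br x a, b) + f (a, br x b)) (cobracket br u y)
    - pairing (\<lambda>(a, b). f (br y a, b) + f (a, br y b)) (cobracket br u x)"
proof -
  note f = assms[unfolded multilinear_form_slots2]
  have "f (x - y, a) = f (x, a) - f (y, a)" "f (a, x - y) = f (a, x) - f (a, y)" for x y a
    using additive.diff[of "\<lambda>x. f (x, a)"] additive.diff[of "\<lambda>x. f (a, x)"]
    by (simp_all add: additive_def f)
  then show ?thesis
    by (simp add: pairing_cobracket jacobi case_prod_unfold pairing_fun)
qed

text \<open>
  Naturality: \<open>\<sigma>(x) \<cdot> (\<sigma> \<otimes> \<sigma>) u = (\<sigma> \<otimes> \<sigma>)(x \<cdot> u)\<close>, and \<open>\<sigma> \<otimes> \<sigma>\<close> fixes \<open>u\<close>.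
\<close>

lemma cobracket_equivariant:
  assumes hom: "\<And>x y. \<sigma> (br x y) = br (\<sigma> x) (\<sigma> y)"
    and inv: "\<And>f. multilinear_form scale slots2 f \<Longrightarrow>
      pairing (\<lambda>(a, b). f (\<sigma> a, \<sigma> b)) u = pairing f u"
    and "multilinear_form scale slots2 f"
  shows "pairing f (cobracket br u (\<sigma> x)) = pairing (\<lambda>(a, b). f (\<sigma> a, \<sigma> b)) (cobracket br u x)"
proof -
  note f = assms(3)[unfolded multilinear_form_slots2]
  have "multilinear_form scale slots2 (\<lambda>(a, b). f (br (\<sigma> x) a, b) + f (a, br (\<sigma> x) b))"
    by (simp add: multilinear_form_slots2 f bilinear algebra_simps)
  from inv[OF this] show ?thesis
    by (simp add: pairing_cobracket hom case_prod_unfold)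
qed

end

locale triangular_r_matrix = lie_bracket scale br
  for scale :: "'k::field \<Rightarrow> 'a::ab_group_add \<Rightarrow> 'a"
    and br :: "'a \<Rightarrow> 'a \<Rightarrow> 'a" +
  fixes u :: "'a \<times> 'a \<Rightarrow>\<^sub>0 'k"
  assumes skew: "multilinear_form scale slots2 f \<Longrightarrow> pairing f u = - pairing (\<lambda>(a, b). f (b, a)) u"
    and cybe: "multilinear_form scale slots3 \<phi> \<Longrightarrow>
      pairing (\<lambda>(a, b). pairing (\<lambda>(c, d).
        \<phi> (br a c, b, d) + \<phi> (a, br b c, d) + \<phi> (a, c, br b d)) u) u = 0"
begin

text \<open>
  The action of \<open>x\<close> commutes with the flip, so the skewness of \<open>u\<close> is inherited.
\<close>

lemma cobracket_skew:
  assumes "multilinear_form scale slots2 f"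
  shows "pairing f (cobracket br u x) = - pairing (\<lambda>(a, b). f (b, a)) (cobracket br u x)"
proof -
  note f = assms[unfolded multilinear_form_slots2]
  have "multilinear_form scale slots2 (\<lambda>(a, b). f (br x a, b) + f (a, br x b))"
    by (simp add: multilinear_form_slots2 f bilinear algebra_simps)
  from skew[OF this] show ?thesis
    by (simp add: pairing_cobracket case_prod_unfold pairing_fun)
qed

text \<open>
  With \<open>u = \<Sum> a \<otimes> b\<close> and a second copy \<open>\<Sum> c \<otimes> d\<close>, the cyclic sum of
  \<open>(id \<otimes> \<delta>) \<delta>(x)\<close> has twelve terms. Interchanging the two copies and using the skewness of each
  copy and of the bracket brings them to a common form. Six terms contain \<open>x\<close> in a bracket of its own and match
  six terms of \<open>x\<close> acting on the Yang-Baxter expression; the other six contain double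
  brackets with \<open>x\<close> innermost, and pair up by the Jacobi identity to
  the three remaining terms, those of the form \<open>{x, {-, -}}\<close>. So the sum is \<open>x \<cdot> 0\<close>.
\<close>

lemma cobracket_cojacobi:
  fixes \<phi> :: "'a \<times> 'a \<times> 'a \<Rightarrow> 'k" and x :: 'a
  assumes "multilinear_form scale slots3 \<phi>"
  defines "K \<equiv> \<lambda>\<psi>. pairing (\<lambda>(a, b). pairing (\<lambda>(c, d). \<psi> (a, c, d)) (cobracket br u b)) (cobracket br u x)"
  shows "K \<phi> + K (\<lambda>(a, b, c). \<phi> (c, a, b)) + K (\<lambda>(a, b, c). \<phi> (b, c, a)) = 0"
proof -
  note \<phi> = assms(1)[unfolded multilinear_form_slots3]
  have \<phi>_minus: "\<phi> (- a, b, c) = - \<phi> (a, b, c)" "\<phi> (a, b, - c) = - \<phi> (a, b, c)"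
      "\<phi> (a, - b, c) = - \<phi> (a, b, c)" for a b c
    using additive.minus[of "\<lambda>a. \<phi> (a, b, c)"] additive.minus[of "\<lambda>b. \<phi> (a, b, c)"]
      additive.minus[of "\<lambda>c. \<phi> (a, b, c)"] by (simp_all add: additive_def \<phi>)
  have \<phi>_diff: "\<phi> (a - a', b, c) = \<phi> (a, b, c) - \<phi> (a', b, c)"
      "\<phi> (a, b - b', c) = \<phi> (a, b, c) - \<phi> (a, b', c)"
      "\<phi> (a, b, c - c') = \<phi> (a, b, c) - \<phi> (a, b, c')" for a b c a' b' c'
    using additive.diff[of "\<lambda>a. \<phi> (a, b, c)"] additive.diff[of "\<lambda>b. \<phi> (a, b, c)"]
      additive.diff[of "\<lambda>c. \<phi> (a, b, c)"] by (simp_all add: additive_def \<phi>)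
  \<comment> \<open>\<open>Q\<close> contracts a function of four vectors with two copies of \<open>u\<close>; \<open>swap\<close>, \<open>flip1\<close> and
    \<open>flip2\<close> are the symmetries of such contractions.\<close>
  define Q where "Q F = pairing (\<lambda>(a, b). pairing (\<lambda>(c, d). F a b c d) u) u"
    for F :: "'a \<Rightarrow> 'a \<Rightarrow> 'a \<Rightarrow> 'a \<Rightarrow> 'k"
  have Q_add: "Q (\<lambda>a b c d. F a b c d + G a b c d) = Q F + Q G" for F G
    by (simp add: Q_def case_prod_unfold pairing_fun)
  have Q_minus: "Q (\<lambda>a b c d. - F a b c d) = - Q F" for F
    by (simp add: Q_def case_prod_unfold pairing_fun)
  have Q_diff: "Q (\<lambda>a b c d. F a b c d - G a b c d) = Q F - Q G" for F G
    by (simp add: Q_def case_prod_unfold pairing_fun)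
  have swap: "Q F = Q (\<lambda>a b c d. F c d a b)" for F
    unfolding Q_def case_prod_unfold by (rule pairing_swap)
  have flip2: "Q F = - Q (\<lambda>a b c d. F a b d c)"
    if "\<And>a b. multilinear_form scale slots2 (\<lambda>(c, d). F a b c d)" for F
    using skew[OF that] by (simp add: Q_def case_prod_unfold pairing_fun)
  have flip1: "Q F = - Q (\<lambda>a b c d. F b a c d)"
    if "\<And>c d. multilinear_form scale slots2 (\<lambda>(a, b). F a b c d)" for F
    using flip2[of "\<lambda>a b c d. F c d a b"] that swap[of F] swap[of "\<lambda>a b c d. F b a c d"] by simp
  note ml = multilinear_form_slots2 multilinear_form_slots3 \<phi> bilinear
  have anti1: "Q (\<lambda>a b c d. \<phi> (br (f a b c d) (g a b c d), h a b c d, k a b c d))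
      = - Q (\<lambda>a b c d. \<phi> (br (g a b c d) (f a b c d), h a b c d, k a b c d))" for f g h k
    by (simp only: Q_minus[symmetric] \<phi>_minus(1)[symmetric] anticommute[symmetric])
  have anti2: "Q (\<lambda>a b c d. \<phi> (h a b c d, br (f a b c d) (g a b c d), k a b c d))
      = - Q (\<lambda>a b c d. \<phi> (h a b c d, br (g a b c d) (f a b c d), k a b c d))" for f g h k
    by (simp only: Q_minus[symmetric] \<phi>_minus(3)[symmetric] anticommute[symmetric])
  have anti3: "Q (\<lambda>a b c d. \<phi> (h a b c d, k a b c d, br (f a b c d) (g a b c d)))
      = - Q (\<lambda>a b c d. \<phi> (h a b c d, k a b c d, br (g a b c d) (f a b c d)))" for f g h k
    by (simp only: Q_minus[symmetric] \<phi>_minus(2)[symmetric] anticommute[symmetric])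
  have K_Q: "K \<psi> = Q (\<lambda>a b c d. \<psi> (br x a, br b c, d)) + Q (\<lambda>a b c d. \<psi> (br x a, c, br b d))
      + Q (\<lambda>a b c d. \<psi> (a, br (br x b) c, d)) + Q (\<lambda>a b c d. \<psi> (a, c, br (br x b) d))" for \<psi>
    by (simp add: K_def Q_def pairing_cobracket case_prod_unfold pairing_fun)
  have cybe_Q: "Q (\<lambda>a b c d. \<psi> (br a c, b, d)) + Q (\<lambda>a b c d. \<psi> (a, br b c, d))
      + Q (\<lambda>a b c d. \<psi> (a, c, br b d)) = 0" if "multilinear_form scale slots3 \<psi>" for \<psi>
    using cybe[OF that] by (simp add: Q_def case_prod_unfold pairing_fun)
  \<comment> \<open>The Yang-Baxter equation with \<open>x\<close> acting on the first, second and third factor.\<close>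
  have c1: "Q (\<lambda>a b c d. \<phi> (br x (br a c), b, d)) + Q (\<lambda>a b c d. \<phi> (br x a, br b c, d))
      + Q (\<lambda>a b c d. \<phi> (br x a, c, br b d)) = 0"
    using cybe_Q[of "\<lambda>(a, b, c). \<phi> (br x a, b, c)"] by (simp add: ml)
  have c2: "Q (\<lambda>a b c d. \<phi> (br a c, br x b, d)) + Q (\<lambda>a b c d. \<phi> (a, br x (br b c), d))
      + Q (\<lambda>a b c d. \<phi> (a, br x c, br b d)) = 0"
    using cybe_Q[of "\<lambda>(a, b, c). \<phi> (a, br x b, c)"] by (simp add: ml)
  have c3: "Q (\<lambda>a b c d. \<phi> (br a c, b, br x d)) + Q (\<lambda>a b c d. \<phi> (a, br b c, br x d))
      + Q (\<lambda>a b c d. \<phi> (a, c, br x (br b d))) = 0"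
    using cybe_Q[of "\<lambda>(a, b, c). \<phi> (a, b, br x c)"] by (simp add: ml)

  \<comment> \<open>The terms of the two rotated summands in which \<open>x\<close> has a bracket of its own; those of the
    unrotated summand already occur in \<open>c1\<close>.\<close>
  have "Q (\<lambda>a b c d. \<phi> (d, br x a, br b c)) = Q (\<lambda>a b c d. \<phi> (b, br x c, br d a))"
    by (rule swap)
  also have "\<dots> = - Q (\<lambda>a b c d. \<phi> (a, br x c, br d b))"
    by (rule flip1) (simp add: ml)
  also have "\<dots> = Q (\<lambda>a b c d. \<phi> (a, br x c, br b d))"
    using anti3[where f = "\<lambda>a b c d. d" and g = "\<lambda>a b c d. b" and h = "\<lambda>a b c d. a" and k = "\<lambda>a b c d. br x c"] by simp
  finally have t1: "Q (\<lambda>a b c d. \<phi> (d, br x a, br b c)) = Q (\<lambda>a b c d. \<phi> (a, br x c, br b d))" .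

  have "Q (\<lambda>a b c d. \<phi> (br b d, br x a, c)) = - Q (\<lambda>a b c d. \<phi> (br a d, br x b, c))"
    by (rule flip1) (simp add: ml)
  also have "\<dots> = Q (\<lambda>a b c d. \<phi> (br a c, br x b, d))"
    by (subst flip2) (simp_all add: ml)
  finally have t2: "Q (\<lambda>a b c d. \<phi> (br b d, br x a, c)) = Q (\<lambda>a b c d. \<phi> (br a c, br x b, d))" .

  have "Q (\<lambda>a b c d. \<phi> (br b c, d, br x a)) = Q (\<lambda>a b c d. \<phi> (br d a, b, br x c))"
    by (rule swap)
  also have "\<dots> = - Q (\<lambda>a b c d. \<phi> (br c a, b, br x d))"
    by (rule flip2) (simp add: ml)
  also have "\<dots> = Q (\<lambda>a b c d. \<phi> (br a c, b, br x d))"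
    using anti1[where f = "\<lambda>a b c d. c" and g = "\<lambda>a b c d. a" and h = "\<lambda>a b c d. b" and k = "\<lambda>a b c d. br x d"] by simp
  finally have t3: "Q (\<lambda>a b c d. \<phi> (br b c, d, br x a)) = Q (\<lambda>a b c d. \<phi> (br a c, b, br x d))" .

  have "Q (\<lambda>a b c d. \<phi> (c, br b d, br x a)) = Q (\<lambda>a b c d. \<phi> (a, br d b, br x c))"
    by (rule swap)
  also have "\<dots> = - Q (\<lambda>a b c d. \<phi> (a, br c b, br x d))"
    by (rule flip2) (simp add: ml)
  also have "\<dots> = Q (\<lambda>a b c d. \<phi> (a, br b c, br x d))"
    using anti2[where f = "\<lambda>a b c d. c" and g = "\<lambda>a b c d. b" and h = "\<lambda>a b c d. a" and k = "\<lambda>a b c d. br x d"] by simp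
  finally have t4: "Q (\<lambda>a b c d. \<phi> (c, br b d, br x a)) = Q (\<lambda>a b c d. \<phi> (a, br b c, br x d))" .

  \<comment> \<open>The double brackets, paired by the factor of the tensor in which they occur.\<close>
  have derivation: "br x (br b d) = br (br x b) d - br (br x d) b" for b d
    using jacobi[of x b d] anticommute[of b "br x d"] by simp

  have "Q (\<lambda>a b c d. \<phi> (d, a, br (br x b) c)) = Q (\<lambda>a b c d. \<phi> (b, c, br (br x d) a))"
    by (rule swap)
  also have "\<dots> = - Q (\<lambda>a b c d. \<phi> (a, c, br (br x d) b))"
    by (rule flip1) (simp add: ml)
  finally have t5: "Q (\<lambda>a b c d. \<phi> (a, c, br (br x b) d)) + Q (\<lambda>a b c d. \<phi> (d, a, br (br x b) c))
      = Q (\<lambda>a b c d. \<phi> (a, c, br x (br b d)))"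
    by (simp add: derivation \<phi>_diff Q_diff)

  have "Q (\<lambda>a b c d. \<phi> (c, br (br x b) d, a)) = Q (\<lambda>a b c d. \<phi> (a, br (br x d) b, c))"
    by (rule swap)
  also have "\<dots> = - Q (\<lambda>a b c d. \<phi> (a, br (br x c) b, d))"
    by (rule flip2) (simp add: ml)
  finally have t6: "Q (\<lambda>a b c d. \<phi> (a, br (br x b) c, d)) + Q (\<lambda>a b c d. \<phi> (c, br (br x b) d, a))
      = Q (\<lambda>a b c d. \<phi> (a, br x (br b c), d))"
    by (simp add: derivation \<phi>_diff Q_diff)

  have "Q (\<lambda>a b c d. \<phi> (br (br x b) d, a, c)) = - Q (\<lambda>a b c d. \<phi> (br (br x a) d, b, c))"
    by (rule flip1) (simp add: ml)
  also have "\<dots> = Q (\<lambda>a b c d. \<phi> (br (br x a) c, b, d))"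
    by (subst flip2) (simp_all add: ml)
  finally have t7: "Q (\<lambda>a b c d. \<phi> (br (br x b) d, a, c)) = Q (\<lambda>a b c d. \<phi> (br (br x a) c, b, d))" .

  have "Q (\<lambda>a b c d. \<phi> (br (br x b) c, d, a)) = Q (\<lambda>a b c d. \<phi> (br (br x d) a, b, c))"
    by (rule swap)
  also have "\<dots> = - Q (\<lambda>a b c d. \<phi> (br (br x c) a, b, d))"
    by (rule flip2) (simp add: ml)
  finally have t8: "Q (\<lambda>a b c d. \<phi> (br (br x b) d, a, c)) + Q (\<lambda>a b c d. \<phi> (br (br x b) c, d, a))
      = Q (\<lambda>a b c d. \<phi> (br x (br a c), b, d))"
    using t7 by (simp add: derivation \<phi>_diff Q_diff)

  have "K \<phi> + K (\<lambda>(a, b, c). \<phi> (c, a, b)) + K (\<lambda>(a, b, c). \<phi> (b, c, a)) =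
     (Q (\<lambda>a b c d. \<phi> (br x (br a c), b, d)) + Q (\<lambda>a b c d. \<phi> (br x a, br b c, d))
      + Q (\<lambda>a b c d. \<phi> (br x a, c, br b d)))
     + (Q (\<lambda>a b c d. \<phi> (br a c, br x b, d)) + Q (\<lambda>a b c d. \<phi> (a, br x (br b c), d))
      + Q (\<lambda>a b c d. \<phi> (a, br x c, br b d)))
     + (Q (\<lambda>a b c d. \<phi> (br a c, b, br x d)) + Q (\<lambda>a b c d. \<phi> (a, br b c, br x d))
      + Q (\<lambda>a b c d. \<phi> (a, c, br x (br b d))))"
    unfolding K_Q prod.case t5[symmetric] t6[symmetric] t8[symmetric] t1 t2 t3 t4
    by (simp only: ac_simps)
  also have "\<dots> = 0"
    by (simp only: c1 c2 c3 add_0)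
  finally show ?thesis .
qed

end

section \<open>Untwisting an involutive BiHom-Lie algebra\<close>

locale involutive_bihom_lie =
  fixes scale :: "'k::field \<Rightarrow> 'a::ab_group_add \<Rightarrow> 'a"
    and br :: "'a \<Rightarrow> 'a \<Rightarrow> 'a" and \<alpha> \<beta> :: "'a \<Rightarrow> 'a"
  assumes algebra: "involutive_bihom_lie_algebra scale br \<alpha> \<beta>"
begin

lemma linear:
  "Vector_Spaces.linear scale scale (br x)" "Vector_Spaces.linear scale scale (\<lambda>x. br x y)"
  "Vector_Spaces.linear scale scale \<alpha>" "Vector_Spaces.linear scale scale \<beta>"
  using algebra by (auto simp: involutive_bihom_lie_algebra_def bihom_lie_algebra_def)

lemmas linear_simps =
  linear_add_scale[OF linear(1)] linear_add_scale[OF linear(2)]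
  linear_add_scale[OF linear(3)] linear_add_scale[OF linear(4)]

lemma twist [simp]: "\<alpha> (\<alpha> x) = x" "\<beta> (\<beta> x) = x" "\<alpha> (\<beta> x) = \<beta> (\<alpha> x)"
  using algebra
  by (auto simp: involutive_bihom_lie_algebra_def bihom_lie_algebra_def fun_eq_iff)

lemma hom: "\<alpha> (br x y) = br (\<alpha> x) (\<alpha> y)" "\<beta> (br x y) = br (\<beta> x) (\<beta> y)"
  using algebra by (auto simp: involutive_bihom_lie_algebra_def bihom_lie_algebra_def)

lemma bij_\<alpha>: "bij \<alpha>"
  by (rule o_bij[of \<alpha>]) auto

lemma inv_\<alpha> [simp]: "inv \<alpha> = \<alpha>"
  by (rule inv_unique_comp) (auto simp: fun_eq_iff)

definition untwisted :: "'a \<Rightarrow> 'a \<Rightarrow> 'a" where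
  "untwisted x y = br (\<alpha> x) (\<beta> y)"

lemma untwisted_hom:
  "\<alpha> (untwisted x y) = untwisted (\<alpha> x) (\<alpha> y)" "\<beta> (untwisted x y) = untwisted (\<beta> x) (\<beta> y)"
  by (simp_all add: untwisted_def hom)

text \<open>
  Substituting \<open>\<beta> (\<alpha> x)\<close> and similar vectors in the BiHom axioms removes all twists, since
  every element is in the image of \<open>\<alpha>\<close> and \<open>\<beta>\<close>.
\<close>

sublocale lie: lie_bracket scale untwisted
proof
  show anti: "untwisted x y = - untwisted y x" for x y
  proof -
    have "br (\<beta> (\<beta> (\<alpha> x))) (\<alpha> (\<beta> (\<alpha> y))) = - br (\<beta> (\<beta> (\<alpha> y))) (\<alpha> (\<beta> (\<alpha> x)))"
      using algebra unfolding involutive_bihom_lie_algebra_def bihom_lie_algebra_def by blast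
    then show ?thesis by (simp add: untwisted_def)
  qed
  have minus: "untwisted x (- y) = - untwisted x y" for x y
  proof -
    have "untwisted x (- y) + untwisted x y = untwisted x (- y + y)"
      by (simp only: untwisted_def linear_simps)
    also have "\<dots> = 0"
      using linear_simps(1)[of "\<alpha> x" 0 0] linear_simps(7)[of 0 0] by (simp add: untwisted_def)
    finally show ?thesis by (simp add: eq_neg_iff_add_eq_0)
  qed
  show "untwisted (untwisted x y) z = untwisted x (untwisted y z) - untwisted y (untwisted x z)"
    for x y z
  proof -
    have "br (\<beta> (\<beta> (\<alpha> x))) (br (\<beta> (\<alpha> y)) (\<alpha> (\<alpha> z))) + br (\<beta> (\<beta> (\<alpha> y))) (br (\<beta> (\<alpha> z)) (\<alpha> (\<alpha> x)))
        + br (\<beta> (\<beta> (\<alpha> z))) (br (\<beta> (\<alpha> x)) (\<alpha> (\<alpha> y))) = 0"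
      using algebra unfolding involutive_bihom_lie_algebra_def bihom_lie_algebra_def by blast
    then have "untwisted x (untwisted y z) + untwisted y (untwisted z x)
        + untwisted z (untwisted x y) = 0"
      by (simp add: untwisted_def hom)
    then show ?thesis
      unfolding anti[of z x] minus anti[of z "untwisted x y"]
      by (simp add: algebra_simps)
  qed
qed (simp_all add: untwisted_def linear_simps)

end

locale involutive_bihom_r_matrix = involutive_bihom_lie scale br \<alpha> \<beta>
  for scale :: "'k::field \<Rightarrow> 'a::ab_group_add \<Rightarrow> 'a"
    and br :: "'a \<Rightarrow> 'a \<Rightarrow> 'a" and \<alpha> \<beta> :: "'a \<Rightarrow> 'a" +
  fixes u :: "'a \<times> 'a \<Rightarrow>\<^sub>0 'k"
  assumes cbhybe: "CBHYB scale br \<alpha> \<beta> (tensor_class scale slots2 u) = tensor_zero scale slots3"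
    and skew: "tensor_class scale slots2 u
      = tensor_uminus scale slots2 (flip scale (tensor_class scale slots2 u))"
    and inv_\<alpha>\<alpha>: "tensor_map2 scale \<alpha> \<alpha> (tensor_class scale slots2 u) = tensor_class scale slots2 u"
    and inv_\<beta>\<beta>: "tensor_map2 scale \<beta> \<beta> (tensor_class scale slots2 u) = tensor_class scale slots2 u"
begin

lemma pairing_skew:
  assumes "multilinear_form scale slots2 f"
  shows "pairing f u = - pairing (\<lambda>(a, b). f (b, a)) u"
  using skew assms
  by (simp add: flip_class tensor_uminus_class tensor_class_eq_iff_forms case_prod_unfold)

lemma pairing_invariant:
  assumes "multilinear_form scale slots2 f"
  shows "pairing (\<lambda>(a, b). f (\<alpha> a, \<alpha> b)) u = pairing f u"
    and "pairing (\<lambda>(a, b). f (\<beta> a, \<beta> b)) u = pairing f u"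
  using inv_\<alpha>\<alpha> inv_\<beta>\<beta> assms
  by (simp_all add: tensor_map2_class linear tensor_class_eq_iff_forms case_prod_unfold)

lemma pairing_cbhybe:
  assumes "multilinear_form scale slots3 \<phi>"
  shows "pairing (\<lambda>(a, b). pairing (\<lambda>(c, d).
      \<phi> (br a (\<beta> (\<alpha> c)), \<beta> b, \<beta> d) + \<phi> (\<beta> a, br b (\<beta> (\<alpha> c)), \<beta> d)
      + \<phi> (\<beta> a, \<beta> c, br b (\<beta> (\<alpha> d)))) u) u = 0"
  using cbhybe assms algebra CBHYB_class[of scale br \<alpha> \<beta> u, OF _ bij_\<alpha>]
  by (simp add: involutive_bihom_lie_algebra_def tensor_zero_def
      tensor_class_eq_iff_forms case_prod_unfold)

text \<open>
  The factor \<open>\<beta>\<alpha>\<close> compensates the map \<open>\<alpha>\<inverse>\<beta>\<close> that \<open>CBHYB\<close> applies to one argument of each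
  bracket. By the invariance of \<open>u\<close> it can be moved to the other factor.
\<close>

definition r_matrix :: "'a \<times> 'a \<Rightarrow>\<^sub>0 'k" where
  "r_matrix = lin_ext (\<lambda>(a, b). gen (\<beta> (\<alpha> a), b)) u"

lemma pairing_r_matrix: "pairing f r_matrix = pairing (\<lambda>(a, b). f (\<beta> (\<alpha> a), b)) u"
  by (simp add: r_matrix_def case_prod_unfold)

lemma pairing_invariant_both:
  assumes "multilinear_form scale slots2 f"
  shows "pairing (\<lambda>(a, b). f (\<beta> (\<alpha> a), \<beta> (\<alpha> b))) u = pairing f u"
proof -
  have "multilinear_form scale slots2 (\<lambda>(a, b). f (\<beta> a, \<beta> b))"
    using assms by (simp add: multilinear_form_slots2 linear_simps)
  from pairing_invariant(1)[OF this] pairing_invariant(2)[OF assms] show ?thesis by simp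
qed

text \<open>
  After applying \<open>\<beta> \<otimes> \<beta> \<otimes> \<beta>\<close>, each of the three brackets in \<open>CBHYB\<close> is \<open>{\<gamma> s, \<gamma> t}\<close> with
  \<open>\<gamma> = \<beta>\<alpha>\<close>, and the other factors are free of twists. In the Yang-Baxter expression of
  \<open>(\<gamma> \<otimes> id) u\<close> it is the first factor of each copy that carries \<open>\<gamma>\<close>. The first summands coincide;
  the second ones agree by the invariance of the first copy, the third ones by that of both copies.
\<close>

sublocale triangular: triangular_r_matrix scale untwisted r_matrix
proof
  fix f :: "'a \<times> 'a \<Rightarrow> 'k" assume f: "multilinear_form scale slots2 f"
  note f' = f[unfolded multilinear_form_slots2]
  have "pairing f r_matrix = pairing (\<lambda>(a, b). f (a, \<beta> (\<alpha> b))) u"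
    using pairing_invariant_both[of "\<lambda>(a, b). f (a, \<beta> (\<alpha> b))"]
    by (simp add: pairing_r_matrix multilinear_form_slots2 f' linear_simps)
  also have "\<dots> = - pairing (\<lambda>(a, b). f (b, a)) r_matrix"
    using pairing_skew[of "\<lambda>(a, b). f (a, \<beta> (\<alpha> b))"]
    by (simp add: pairing_r_matrix multilinear_form_slots2 f' linear_simps)
  finally show "pairing f r_matrix = - pairing (\<lambda>(a, b). f (b, a)) r_matrix" .
next
  fix \<phi> :: "'a \<times> 'a \<times> 'a \<Rightarrow> 'k" assume "multilinear_form scale slots3 \<phi>"
  note \<phi> = this[unfolded multilinear_form_slots3]
  note ml = multilinear_form_slots2 multilinear_form_slots3 \<phi> linear_simps lie.bilinear
  let ?\<gamma> = "\<lambda>x. \<beta> (\<alpha> x)"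
  have "multilinear_form scale slots3 (\<lambda>(x, y, z). \<phi> (\<beta> x, \<beta> y, \<beta> z))"
    by (simp add: ml)
  from pairing_cbhybe[OF this]
  have eq: "pairing (\<lambda>(a, b). pairing (\<lambda>(c, d). \<phi> (untwisted (?\<gamma> a) (?\<gamma> c), b, d)) u) u
    + pairing (\<lambda>(a, b). pairing (\<lambda>(c, d). \<phi> (a, untwisted (?\<gamma> b) (?\<gamma> c), d)) u) u
    + pairing (\<lambda>(a, b). pairing (\<lambda>(c, d). \<phi> (a, c, untwisted (?\<gamma> b) (?\<gamma> d))) u) u = 0"
    by (simp add: untwisted_def hom case_prod_unfold pairing_fun)
  have "multilinear_form scale slots2
      (\<lambda>(a, b). pairing (\<lambda>(c, d). \<phi> (a, untwisted (?\<gamma> b) (?\<gamma> c), d)) u)"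
    by (simp add: ml case_prod_unfold pairing_fun)
  from pairing_invariant_both[OF this]
  have second: "pairing (\<lambda>(a, b). pairing (\<lambda>(c, d). \<phi> (a, untwisted (?\<gamma> b) (?\<gamma> c), d)) u) u
      = pairing (\<lambda>(a, b). pairing (\<lambda>(c, d). \<phi> (?\<gamma> a, untwisted b (?\<gamma> c), d)) u) u"
    by (simp add: case_prod_unfold)
  have "multilinear_form scale slots2
      (\<lambda>(a, b). pairing (\<lambda>(c, d). \<phi> (a, c, untwisted (?\<gamma> b) (?\<gamma> d))) u)"
    by (simp add: ml case_prod_unfold pairing_fun)
  from pairing_invariant_both[OF this]
  have "pairing (\<lambda>(a, b). pairing (\<lambda>(c, d). \<phi> (a, c, untwisted (?\<gamma> b) (?\<gamma> d))) u) u
      = pairing (\<lambda>(a, b). pairing (\<lambda>(c, d). \<phi> (?\<gamma> a, c, untwisted b (?\<gamma> d))) u) u"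
    by (simp add: case_prod_unfold)
  also have "\<dots> = pairing (\<lambda>(a, b). pairing (\<lambda>(c, d). \<phi> (?\<gamma> a, ?\<gamma> c, untwisted b d)) u) u"
  proof -
    have "pairing (\<lambda>(c, d). \<phi> (?\<gamma> a, c, untwisted b (?\<gamma> d))) u
        = pairing (\<lambda>(c, d). \<phi> (?\<gamma> a, ?\<gamma> c, untwisted b d)) u" for a b
      using pairing_invariant_both[of "\<lambda>(c, d). \<phi> (?\<gamma> a, c, untwisted b (?\<gamma> d))"]
      by (simp add: ml)
    then show ?thesis by simp
  qed
  finally show "pairing (\<lambda>(a, b). pairing (\<lambda>(c, d). \<phi> (untwisted a c, b, d)
      + \<phi> (a, untwisted b c, d) + \<phi> (a, c, untwisted b d)) r_matrix) r_matrix = 0"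
    using eq second by (simp add: pairing_r_matrix case_prod_unfold pairing_fun)
qed

section \<open>The BiHom-Lie bialgebra\<close>

abbreviation \<delta> :: "'a \<Rightarrow> ('a \<times> 'a \<Rightarrow>\<^sub>0 'k)" where
  "\<delta> \<equiv> cobracket untwisted r_matrix"

abbreviation \<Delta> :: "'a \<Rightarrow> ('a \<times> 'a \<Rightarrow>\<^sub>0 'k) set" where
  "\<Delta> \<equiv> coboundary scale br \<alpha> \<beta> (tensor_class scale slots2 u)"

text \<open>
  For a generator \<open>a \<otimes> b\<close> of \<open>u\<close> both sides are
  \<open>[x, a] \<otimes> \<beta> b + \<beta> a \<otimes> [\<alpha>\<beta> x, b]\<close>; the factor \<open>\<beta>\<alpha>\<close> in \<open>r_matrix\<close> is what makes the twists agree.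
\<close>

lemma coboundary_twisted:
  "\<Delta> x = tensor_class scale slots2 (lin_ext (\<lambda>(a, b). gen (\<alpha> a, \<beta> b)) (\<delta> x))"
  by (simp add: coboundary_def tensor_map2_class linear tensor_add_class tensor_class_eq_iff_forms
      pairing_cobracket pairing_r_matrix case_prod_unfold pairing_fun untwisted_def hom)

lemma \<delta>_equivariant:
  assumes "multilinear_form scale slots2 f"
  shows "pairing f (\<delta> (\<alpha> x)) = pairing (\<lambda>(a, b). f (\<alpha> a, \<alpha> b)) (\<delta> x)"
    and "pairing f (\<delta> (\<beta> x)) = pairing (\<lambda>(a, b). f (\<beta> a, \<beta> b)) (\<delta> x)"
proof -
  have inv: "pairing (\<lambda>(a, b). g (\<alpha> a, \<alpha> b)) r_matrix = pairing g r_matrix"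
    "pairing (\<lambda>(a, b). g (\<beta> a, \<beta> b)) r_matrix = pairing g r_matrix"
    if "multilinear_form scale slots2 g" for g
  proof -
    have "multilinear_form scale slots2 (\<lambda>(a, b). g (\<beta> (\<alpha> a), b))"
      using that by (simp add: multilinear_form_slots2 linear_simps)
    from pairing_invariant[OF this]
    show "pairing (\<lambda>(a, b). g (\<alpha> a, \<alpha> b)) r_matrix = pairing g r_matrix"
      "pairing (\<lambda>(a, b). g (\<beta> a, \<beta> b)) r_matrix = pairing g r_matrix"
      by (simp_all add: pairing_r_matrix)
  qed
  show "pairing f (\<delta> (\<alpha> x)) = pairing (\<lambda>(a, b). f (\<alpha> a, \<alpha> b)) (\<delta> x)"
    by (rule lie.cobracket_equivariant)
      (auto simp: untwisted_hom inv assms)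
  show "pairing f (\<delta> (\<beta> x)) = pairing (\<lambda>(a, b). f (\<beta> a, \<beta> b)) (\<delta> x)"
    by (rule lie.cobracket_equivariant)
      (auto simp: untwisted_hom inv assms)
qed

lemma \<delta>_linear:
  assumes "multilinear_form scale slots2 f"
  shows "pairing f (\<delta> (x + y)) = pairing f (\<delta> x) + pairing f (\<delta> y)"
    and "pairing f (\<delta> (scale c x)) = c * pairing f (\<delta> x)"
  using assms
  by (simp_all add: multilinear_form_slots2 pairing_cobracket lie.bilinear case_prod_unfold
      pairing_fun distrib_left)

lemma linear_comult_coboundary: "linear_comult scale \<Delta>"
  unfolding linear_comult_def coboundary_twisted
  by (auto simp: tensor_space_def tensor_add_class tensor_scale_class tensor_class_eq_iff_forms
      \<delta>_linear multilinear_form_slots2 linear_simps case_prod_unfold)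

text \<open>
  \<open>J\<close> is the image of \<open>(id \<otimes> \<delta>) \<delta>(x)\<close> under \<open>\<alpha> \<otimes> \<alpha> \<otimes> \<alpha>\<close>: the inner \<open>\<delta>\<close> is evaluated at
  \<open>\<beta> b\<close>, and moving this \<open>\<beta>\<close> out of \<open>\<delta>\<close> cancels those in the last two factors.
\<close>

lemma coboundary_cojacobi:
  fixes x :: 'a
  defines "J \<equiv> tensor_map3 scale id \<beta> \<alpha> (tensor_map_comult scale (\<beta> \<circ> \<beta>) \<Delta> (\<Delta> x))"
  shows "tensor_add scale slots3
      (tensor_add scale slots3 J (flip_id scale (id_flip scale J)))
      (id_flip scale (flip_id scale J)) = tensor_zero scale slots3"
proof -
  have id: "\<beta> \<circ> \<beta> = id" by auto
  have lin_id: "Vector_Spaces.linear scale scale id"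
    using Vector_Spaces.linear_compose[OF linear(4,4)] by (simp add: id)
  define j where "j = lin_ext (\<lambda>(x, y, z). gen (x, \<beta> y, \<alpha> z))
    (lin_ext (\<lambda>(x, y). lin_ext (\<lambda>(a, b). gen (x, a, b)) (rep (\<Delta> y)))
      (lin_ext (\<lambda>(a, b). gen (\<alpha> a, \<beta> b)) (\<delta> x)))"
  have J: "J = tensor_class scale slots3 j"
    unfolding J_def j_def id coboundary_twisted[of x]
    by (simp add: tensor_map_comult_class[OF lin_id linear_comult_coboundary]
      tensor_map3_class[OF lin_id linear(4,3)])
  have j: "pairing \<phi> j = pairing (\<lambda>(a, b). pairing (\<lambda>(c, d). \<phi> (\<alpha> a, \<alpha> c, \<alpha> d)) (\<delta> b)) (\<delta> x)"
    if \<phi>: "multilinear_form scale slots3 \<phi>" for \<phi>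
  proof -
    note \<phi>' = \<phi>[unfolded multilinear_form_slots3]
    have "pairing (\<lambda>(c, d). \<phi> (a, \<beta> c, \<alpha> d)) (rep (\<Delta> (\<beta> b)))
        = pairing (\<lambda>(c, d). \<phi> (a, \<alpha> c, \<alpha> d)) (\<delta> b)" for a b
    proof -
      have "pairing (\<lambda>(c, d). \<phi> (a, \<beta> c, \<alpha> d)) (rep (\<Delta> (\<beta> b)))
          = pairing (\<lambda>(c, d). \<phi> (a, \<beta> (\<alpha> c), \<beta> (\<alpha> d))) (\<delta> (\<beta> b))"
        unfolding coboundary_twisted
        by (subst pairing_rep_class) (simp_all add: multilinear_form_slots2 \<phi>' linear_simps case_prod_unfold)
      also have "\<dots> = pairing (\<lambda>(c, d). \<phi> (a, \<alpha> c, \<alpha> d)) (\<delta> b)"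
        by (subst \<delta>_equivariant(2)) (simp_all add: multilinear_form_slots2 \<phi>' linear_simps)
      finally show ?thesis .
    qed
    then show ?thesis by (simp add: j_def case_prod_unfold)
  qed
  show ?thesis
    unfolding J id_flip_class flip_id_class tensor_add_class tensor_zero_def tensor_class_eq_iff_forms
  proof (intro allI impI)
    fix \<phi> :: "'a \<times> 'a \<times> 'a \<Rightarrow> 'k" assume \<phi>: "multilinear_form scale slots3 \<phi>"
    note \<phi>' = \<phi>[unfolded multilinear_form_slots3]
    have rot: "multilinear_form scale slots3 (\<lambda>(a, b, c). \<phi> (c, a, b))"
      "multilinear_form scale slots3 (\<lambda>(a, b, c). \<phi> (b, c, a))"
      "multilinear_form scale slots3 (\<lambda>(a, b, c). \<phi> (\<alpha> a, \<alpha> b, \<alpha> c))"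
      by (simp_all add: multilinear_form_slots3 \<phi>' linear_simps)
    show "pairing \<phi> (j + lin_ext (\<lambda>(x, y, z). gen (y, x, z)) (lin_ext (\<lambda>(x, y, z). gen (x, z, y)) j)
        + lin_ext (\<lambda>(x, y, z). gen (x, z, y)) (lin_ext (\<lambda>(x, y, z). gen (y, x, z)) j)) = pairing \<phi> 0"
      using triangular.cobracket_cojacobi[OF rot(3), of x] j[OF \<phi>] j[OF rot(1)] j[OF rot(2)]
      by (simp add: case_prod_unfold)
  qed
qed

lemma coalgebra: "bihom_lie_coalgebra scale \<Delta> \<alpha> \<beta>"
  unfolding bihom_lie_coalgebra_def Let_def
proof (intro conjI allI)
  show "\<Delta> (\<alpha> x) = tensor_map2 scale \<alpha> \<alpha> (\<Delta> x)" "\<Delta> (\<beta> x) = tensor_map2 scale \<beta> \<beta> (\<Delta> x)" for x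
    by (auto simp: coboundary_twisted tensor_map2_class linear tensor_class_eq_iff_forms
        \<delta>_equivariant multilinear_form_slots2 linear_simps case_prod_unfold)
  show "tensor_add scale slots2 (tensor_map2 scale \<beta> \<alpha> (\<Delta> x))
      (flip scale (tensor_map2 scale \<beta> \<alpha> (\<Delta> x))) = tensor_zero scale slots2" for x
    unfolding coboundary_twisted tensor_map2_class[OF linear(4,3)] flip_class tensor_add_class
      tensor_zero_def tensor_class_eq_iff_forms
  proof (intro allI impI)
    fix f assume f: "multilinear_form scale slots2 f"
    have "multilinear_form scale slots2 (\<lambda>(a, b). f (\<beta> (\<alpha> a), \<beta> (\<alpha> b)))"
      using f by (simp add: multilinear_form_slots2 linear_simps)
    from triangular.cobracket_skew[OF this, of x]
    show "pairing f (lin_ext (\<lambda>(x, y). gen (\<beta> x, \<alpha> y)) (lin_ext (\<lambda>(a, b). gen (\<alpha> a, \<beta> b)) (\<delta> x))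
        + lin_ext (\<lambda>(x, y). gen (y, x)) (lin_ext (\<lambda>(x, y). gen (\<beta> x, \<alpha> y))
            (lin_ext (\<lambda>(a, b). gen (\<alpha> a, \<beta> b)) (\<delta> x)))) = pairing f 0"
      by (simp add: case_prod_unfold)
  qed
qed (simp_all add: linear coboundary_cojacobi linear_comult_coboundary fun_eq_iff)

text \<open>
  Both sides of the compatibility condition are the images under \<open>\<beta>\<alpha> \<otimes> id\<close> of those of the
  cocycle identity for \<open>\<delta>\<close>.
\<close>

lemma bialgebra: "bihom_lie_bialgebra scale br \<Delta> \<alpha> \<beta>"
  unfolding bihom_lie_bialgebra_def Let_def
proof (intro conjI allI)
  fix x y
  show "\<Delta> (br (inv \<alpha> (\<beta> x)) y) = tensor_add scale slots2
      (tensor_add scale slots2 (tensor_map2 scale (br (\<beta> x)) \<beta> (\<Delta> y))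
        (tensor_map2 scale \<beta> (br (inv \<alpha> (\<beta> (\<beta> x)))) (\<Delta> y)))
      (tensor_uminus scale slots2 (tensor_add scale slots2
        (tensor_map2 scale (br (\<beta> y)) \<beta> (\<Delta> x))
        (tensor_map2 scale \<beta> (br (inv \<alpha> (\<beta> (\<beta> y)))) (\<Delta> x))))"
    unfolding coboundary_twisted tensor_map2_class[OF linear(1,4)] tensor_map2_class[OF linear(4,1)]
      tensor_add_class tensor_uminus_class tensor_class_eq_iff_forms
  proof (intro allI impI)
    fix f assume "multilinear_form scale slots2 f"
    note f = this[unfolded multilinear_form_slots2]
    have "br (inv \<alpha> (\<beta> x)) y = \<beta> (untwisted x y)"
      by (simp add: untwisted_def hom)
    then have "pairing f (lin_ext (\<lambda>(a, b). gen (\<alpha> a, \<beta> b)) (\<delta> (br (inv \<alpha> (\<beta> x)) y)))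
        = pairing (\<lambda>(a, b). f (\<beta> (\<alpha> a), b)) (\<delta> (untwisted x y))"
      using \<delta>_equivariant(2)[of "\<lambda>(a, b). f (\<alpha> a, \<beta> b)"]
      by (simp add: case_prod_unfold multilinear_form_slots2 f linear_simps)
    also have "\<dots> = pairing (\<lambda>(a, b). f (\<beta> (\<alpha> (untwisted x a)), b) + f (\<beta> (\<alpha> a), untwisted x b)) (\<delta> y)
        - pairing (\<lambda>(a, b). f (\<beta> (\<alpha> (untwisted y a)), b) + f (\<beta> (\<alpha> a), untwisted y b)) (\<delta> x)"
      using lie.cobracket_cocycle[of "\<lambda>(a, b). f (\<beta> (\<alpha> a), b)" r_matrix x y]
      by (simp add: multilinear_form_slots2 f linear_simps)
    finally show "pairing f (lin_ext (\<lambda>(a, b). gen (\<alpha> a, \<beta> b)) (\<delta> (br (inv \<alpha> (\<beta> x)) y))) =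
       pairing f
        (lin_ext (\<lambda>(xa, y). gen (br (\<beta> x) xa, \<beta> y)) (lin_ext (\<lambda>(a, b). gen (\<alpha> a, \<beta> b)) (\<delta> y)) +
         lin_ext (\<lambda>(xa, y). gen (\<beta> xa, br (inv \<alpha> (\<beta> (\<beta> x))) y))
          (lin_ext (\<lambda>(a, b). gen (\<alpha> a, \<beta> b)) (\<delta> y)) +
         - (lin_ext (\<lambda>(x, ya). gen (br (\<beta> y) x, \<beta> ya)) (lin_ext (\<lambda>(a, b). gen (\<alpha> a, \<beta> b)) (\<delta> x)) +
            lin_ext (\<lambda>(x, ya). gen (\<beta> x, br (inv \<alpha> (\<beta> (\<beta> y))) ya))
             (lin_ext (\<lambda>(a, b). gen (\<alpha> a, \<beta> b)) (\<delta> x))))"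
      by (simp add: untwisted_def hom case_prod_unfold pairing_fun)
  qed
qed (use algebra in \<open>auto simp: involutive_bihom_lie_algebra_def intro: coalgebra bij_\<alpha>\<close>)

end

theorem theorem2p47:
  fixes scale :: "'k::field \<Rightarrow> 'a::ab_group_add \<Rightarrow> 'a"
    and Basis :: "'a set"
    and br :: "'a \<Rightarrow> 'a \<Rightarrow> 'a"
    and \<alpha> \<beta> :: "'a \<Rightarrow> 'a"
    and r :: "('a \<times> 'a \<Rightarrow>\<^sub>0 'k) set"
  assumes "finite_dimensional_vector_space scale Basis"
    and "involutive_bihom_lie_algebra scale br \<alpha> \<beta>"
    and "r \<in> tensor_space scale slots2"
    and "CBHYB scale br \<alpha> \<beta> r = tensor_zero scale slots3"
    and "r = tensor_uminus scale slots2 (flip scale r)"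
    and "tensor_map2 scale \<alpha> \<alpha> r = r"
    and "tensor_map2 scale \<beta> \<beta> r = r"
  shows "bihom_lie_bialgebra scale br (coboundary scale br \<alpha> \<beta> r) \<alpha> \<beta>"
proof -
  have r: "tensor_class scale slots2 (rep r) = r"
    using assms(3) by (rule tensor_space_rep)
  interpret involutive_bihom_r_matrix scale br \<alpha> \<beta> "rep r"
    by unfold_locales (unfold r, (fact assms)+)
  from bialgebra show ?thesis unfolding r .
qed

end
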